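(* Let $\Omega\subseteq\mathbb{O}$ be either a slice domain or a product domain and let $f:\Omega\to\mathbb{O}$ be a slice regular function. Let $N_f=\{x_0\in\Omega: df_{x_0}\text{ is not invertible}\}$. Then $N_f$ is the branch set of $f$. More precisely: 1. for every point $x_0\in\Omega\setminus N_f$, there exists an open neighborhood $U$ of $x_0$ in $\Omega$ such that $f(U)$ is open and $f_{|U}:U\to f(U)$ is a diffeomorphism; and 2. for every point $x_0\in N_f$ and for every neighborhood $U$ of $x_0$ in $\Omega$, $f_{|U}$ is not injective. If, moreover, the restriction $f_{|\Omega\setminus N_f}:\Omega\setminus N_f\to f(\Omega\setminus N_f)$ is proper, then $f:\Omega\to f(\Omega)$ is a branched covering.
   Context: $\mathbb{O}$ is the real algebra of octonions, identified with $\mathbb{R}^8$; $\mathbb{S}=\{J\in\mathbb{O}: J^2=-1\}$; $\mathbb{C}_J=\mathbb{R}+J\mathbb{R}$ for $J\in\mathbb{S}$. Circular sets. For a nonempty $D\subseteq\mathbb{C}$ invariant under complex conjugation, $\Omega_D=\{\alpha+\beta J:\alpha+i\beta\in D,\ J\in\mathbb{S}\}$. When $D$ is open, $\Omega_D$ is a slice domain if $D$ is connected and meets $\mathbb{R}$; it is a product domain if $D\cap\mathbb{R}=\emptyset$ and $D$ has exactly two connected components, switched by complex conjugation. Slice regular functions. Let $\mathbb{O}_{\mathbb{C}}=\mathbb{O}\otimes_{\mathbb{R}}\mathbb{C}=\{x+\imath y: x,y\in\mathbb{O}\}$ with $\overline{x+\imath y}=x-\imath y$. A stem function is a map $F=F_1+\imath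 F_2:D\to\mathbb{O}_{\mathbb{C}}$ with $F(\bar z)=\overline{F(z)}$; it induces the slice function $f:\Omega_D\to\mathbb{O}$, $f(\alpha+\beta J)=F_1(\alpha+i\beta)+JF_2(\alpha+i\beta)$. If $\Omega_D$ is open, $f$ is slice regular when $F$ is continuously differentiable and $\frac{\partial F}{\partial\alpha}+\imath\frac{\partial F}{\partial\beta}\equiv0$. Slice regular functions are real analytic; $df_{x_0}$ is the real differential. The branch set of $f$ is the set of points near which $f$ fails to be a local homeomorphism onto an open image. Here, "$f:\Omega\to f(\Omega)$ is a branched covering" means that its restriction $f_{|\Omega\setminus N_f}:\Omega\setminus N_f\to f(\Omega\setminus N_f)$ to the complement of the branch set $N_f$ is a covering map. *)

theory Defs
  imports "HOL-Analysis.Analysis"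
begin

text \<open>
  The octonions are obtained from the complex numbers by applying the Cayley-Dickson doubling
  \<open>(a, b) (c, d) = (a c - d\<^sup>* b, d a + b c\<^sup>*)\<close>, \<open>(a, b)\<^sup>* = (a\<^sup>*, - b)\<close> twice. The underlying real
  vector space, its inner product and its topology are those of the iterated product type,
  that is of Euclidean 8-space.
\<close>

type_synonym quaternion = "complex \<times> complex"
type_synonym octonion = "quaternion \<times> quaternion"

definition qconj :: "quaternion \<Rightarrow> quaternion" where
  "qconj p = (cnj (fst p), - snd p)"

definition qmult :: "quaternion \<Rightarrow> quaternion \<Rightarrow> quaternion" where
  "qmult p q = (fst p * fst q - cnj (snd q) * snd p, snd q * fst p + snd p * cnj (fst q))"

definition omult :: "octonion \<Rightarrow> octonion \<Rightarrow> octonion"  (infixl "\<odot>" 70) where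
  "x \<odot> y = (qmult (fst x) (fst y) - qmult (qconj (snd y)) (snd x),
            qmult (snd y) (fst x) + qmult (snd x) (qconj (fst y)))"

definition oone :: octonion where
  "oone = ((1, 0), (0, 0))"

text \<open>
  The product is unital and bilinear with multiplicative Euclidean norm; by Hurwitz's theorem
  this determines the 8-dimensional algebra up to isomorphism.
\<close>

lemma oone_omult [simp]: "oone \<odot> x = x"
  by (cases x) (auto simp: oone_def omult_def qmult_def qconj_def zero_prod_def)

lemma omult_oone [simp]: "x \<odot> oone = x"
  by (cases x) (auto simp: oone_def omult_def qmult_def qconj_def zero_prod_def)

lemma DIM_octonion: "DIM(octonion) = 8"
  by simp

lemma norm_omult: "norm (x \<odot> y) = norm x * norm y"
proof -
  have "(norm (x \<odot> y))\<^sup>2 = (norm x)\<^sup>2 * (norm y)\<^sup>2"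
    by (simp add: norm_prod_def cmod_power2 omult_def qmult_def qconj_def) algebra
  then show ?thesis
    by (metis norm_ge_zero mult_nonneg_nonneg power2_eq_imp_eq power_mult_distrib)
qed

lemma bilinear_omult: "bilinear omult"
  unfolding bilinear_def
  by (auto intro!: linearI
      simp: omult_def qmult_def qconj_def algebra_simps scaleR_conv_of_real)

definition imag_units :: "octonion set" where
  "imag_units = {J. J \<odot> J = - oone}"

definition conj_invariant :: "complex set \<Rightarrow> bool" where
  "conj_invariant D \<longleftrightarrow> (\<forall>z\<in>D. cnj z \<in> D)"

definition circular_set :: "complex set \<Rightarrow> octonion set" where
  "circular_set D = {\<alpha> *\<^sub>R oone + \<beta> *\<^sub>R J | \<alpha> \<beta> J. Complex \<alpha> \<beta> \<in> D \<and> J \<in> imag_units}"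

definition slice_domain :: "octonion set \<Rightarrow> bool" where
  "slice_domain \<Omega> \<longleftrightarrow>
     (\<exists>D. open D \<and> conj_invariant D \<and> \<Omega> = circular_set D \<and>
          connected D \<and> D \<inter> \<real> \<noteq> {})"

definition product_domain :: "octonion set \<Rightarrow> bool" where
  "product_domain \<Omega> \<longleftrightarrow>
     (\<exists>D. open D \<and> conj_invariant D \<and> \<Omega> = circular_set D \<and>
          D \<inter> \<real> = {} \<and> (\<exists>C. components D = {C, cnj ` C} \<and> C \<noteq> cnj ` C))"

text \<open>An element \<open>x + \<iota> y\<close> of the complexified octonions is represented by the pair \<open>(x, y)\<close>.\<close>

type_synonym octonion_C = "octonion \<times> octonion"

definition oc_conj :: "octonion_C \<Rightarrow> octonion_C" where
  "oc_conj w = (fst w, - snd w)"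

definition iota_mult :: "octonion_C \<Rightarrow> octonion_C" where
  "iota_mult w = (- snd w, fst w)"

definition stem_function :: "complex set \<Rightarrow> (complex \<Rightarrow> octonion_C) \<Rightarrow> bool" where
  "stem_function D F \<longleftrightarrow> (\<forall>z\<in>D. F (cnj z) = oc_conj (F z))"

definition induces :: "complex set \<Rightarrow> (complex \<Rightarrow> octonion_C) \<Rightarrow> (octonion \<Rightarrow> octonion) \<Rightarrow> bool" where
  "induces D F f \<longleftrightarrow>
     (\<forall>\<alpha> \<beta>. \<forall>J\<in>imag_units. Complex \<alpha> \<beta> \<in> D \<longrightarrow>
        f (\<alpha> *\<^sub>R oone + \<beta> *\<^sub>R J) = fst (F (Complex \<alpha> \<beta>)) + J \<odot> snd (F (Complex \<alpha> \<beta>)))"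

text \<open>
  \<open>F' z 1\<close> and \<open>F' z \<i>\<close> are the partial derivatives of \<open>F\<close> at \<open>z = \<alpha> + \<i> \<beta>\<close> with respect
  to \<open>\<alpha>\<close> and \<open>\<beta>\<close>.
\<close>

definition holomorphic_stem :: "complex set \<Rightarrow> (complex \<Rightarrow> octonion_C) \<Rightarrow> bool" where
  "holomorphic_stem D F \<longleftrightarrow>
     (\<exists>F' :: complex \<Rightarrow> complex \<Rightarrow>\<^sub>L octonion_C.
        (\<forall>z\<in>D. (F has_derivative blinfun_apply (F' z)) (at z)) \<and> continuous_on D F' \<and>
        (\<forall>z\<in>D. blinfun_apply (F' z) 1 + iota_mult (blinfun_apply (F' z) \<i>) = 0))"

text \<open>
  A conjugation-invariant \<open>D\<close> is determined by \<open>circular_set D\<close>, so the existential quantifier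
  over \<open>D\<close> involves no choice. Only the values of \<open>f\<close> on \<open>\<Omega>\<close> matter.
\<close>

definition slice_regular :: "octonion set \<Rightarrow> (octonion \<Rightarrow> octonion) \<Rightarrow> bool" where
  "slice_regular \<Omega> f \<longleftrightarrow>
     (\<exists>D F. D \<noteq> {} \<and> open D \<and> conj_invariant D \<and> \<Omega> = circular_set D \<and>
            stem_function D F \<and> holomorphic_stem D F \<and> induces D F f)"

text \<open>
  Slice regular functions are differentiable on their (open) domain, so the Frechet derivative
  below is the real differential.
\<close>

definition singular_set :: "octonion set \<Rightarrow> (octonion \<Rightarrow> octonion) \<Rightarrow> octonion set" where
  "singular_set \<Omega> f = {x \<in> \<Omega>. \<not> bij (frechet_derivative f (at x))}"

definition branch_set :: "'a::topological_space set \<Rightarrow> ('a \<Rightarrow> 'b::topological_space) \<Rightarrow> 'a set" where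
  "branch_set \<Omega> f =
     {x \<in> \<Omega>. \<not> (\<exists>U g. openin (top_of_set \<Omega>) U \<and> x \<in> U \<and> open (f ` U) \<and>
                     homeomorphism U (f ` U) f g)}"

definition branched_covering ::
  "'a::topological_space set \<Rightarrow> ('a \<Rightarrow> 'b::topological_space) \<Rightarrow> bool" where
  "branched_covering \<Omega> f \<longleftrightarrow>
     covering_space (\<Omega> - branch_set \<Omega> f) f (f ` (\<Omega> - branch_set \<Omega> f))"

text \<open>
  Meaningful for open \<open>S\<close> only: the derivatives are taken in the full space. In finite dimension
  \<open>f\<close> is \<open>C\<^sup>k\<^sup>+\<^sup>1\<close> iff it is differentiable and all its directional derivatives are \<open>C\<^sup>k\<close>.
\<close>

primrec Ck_on :: "nat \<Rightarrow> ('a::euclidean_space \<Rightarrow> 'b::euclidean_space) \<Rightarrow> 'a set \<Rightarrow> bool" where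
  "Ck_on 0 f S \<longleftrightarrow> continuous_on S f"
| "Ck_on (Suc k) f S \<longleftrightarrow>
     (\<forall>x\<in>S. f differentiable (at x)) \<and> (\<forall>v. Ck_on k (\<lambda>x. frechet_derivative f (at x) v) S)"

definition smooth_on :: "('a::euclidean_space \<Rightarrow> 'b::euclidean_space) \<Rightarrow> 'a set \<Rightarrow> bool" where
  "smooth_on f S \<longleftrightarrow> (\<forall>k. Ck_on k f S)"

definition diffeomorphism ::
  "'a::euclidean_space set \<Rightarrow> 'b::euclidean_space set \<Rightarrow> ('a \<Rightarrow> 'b) \<Rightarrow> bool" where
  "diffeomorphism U V f \<longleftrightarrow>
     open U \<and> open V \<and> bij_betw f U V \<and> smooth_on f U \<and> smooth_on (inv_into U f) V"

end

(*
  Write f(a + b J) = P(z) + J Q(z) with z = a + i b. Then q is attained by f on the sphere of z iff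
  the holomorphic function N_q = |P - q|^2 - |Q|^2 + 2 i <P - q, Q> vanishes at z, and for
  q = f(x), with x not real and Q(z) nonzero, df_x is invertible as soon as z is a simple zero of
  N_q; at a real point, df_x is right multiplication by the derivative of F.

  Suppose df is singular at x0 while f is injective near x0. Then Q cannot vanish at nonreal points
  near x0 (f would be constant on a sphere), f is not locally constant in z, and singularity for all
  J near J0 with z fixed forces the derivative of F to vanish at z. Hence there are points x1 near
  x0, over z1, where N_{f(x1)} has a simple zero. By injectivity z1 (and its conjugate, if x0 is
  real) is the only zero in a fixed disc, so the minimum modulus principle, applied to N_{f(x1)}
  divided by its linear factors, bounds the derivative at z1 from below uniformly in x1. This
  contradicts that the derivative (divided by Im z1 if x0 is real) tends to 0 as x1 tends to x0.
*)
theory Submission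
  imports Defs "HOL-Complex_Analysis.Complex_Analysis"
begin

subsection \<open>Octonion algebra\<close>

text \<open>Behind the minimum modulus step stands the splitting of multiple zeros: a singular point
  makes the zero of \<open>N q0\<close> over it more degenerate than a regular point does, and under
  a small change of \<open>q0\<close> it should break up into zeros that give several preimages.
  Bounding a derivative from below avoids counting zeros with multiplicity; it only asks for one
  nearby value whose zero is simple.

  At a real point even an invertible differential gives a double zero, because the zeros at z and
  its conjugate merge there. Hence two linear factors are divided out, and only the size of the
  derivative relative to \<open>Im z\<close> carries information.

  Two further obstacles shape the development. A diffeomorphism is C^\<infinity> here, so the
  inverse function theorem has to be lifted from C^1, and \<open>f\<close> has to be shown smooth
  across the real axis, where neither the unit \<open>J\<close> nor \<open>norm (oim x)\<close> is.
  In place of associativity there are only alternativity and the multiplicative norm.\<close>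

definition oim :: "octonion \<Rightarrow> octonion" where
  "oim x = x - (x \<bullet> oone) *\<^sub>R oone"

definition oconj :: "octonion \<Rightarrow> octonion" where
  "oconj x = (2 * (x \<bullet> oone)) *\<^sub>R oone - x"

lemma bounded_bilinear_omult: "bounded_bilinear omult"
  using bilinear_omult bilinear_conv_bounded_bilinear by blast

interpretation omult: bounded_bilinear omult
  by (rule bounded_bilinear_omult)

lemma norm_oone [simp]: "norm oone = 1"
  by (simp add: oone_def norm_prod_def)

lemma oone_inner_oone [simp]: "oone \<bullet> oone = 1"
  by (simp add: oone_def inner_prod_def)

lemma omult_self: "x \<odot> x = (2 * (x \<bullet> oone)) *\<^sub>R x - (norm x)\<^sup>2 *\<^sub>R oone"
proof -
  obtain a b c d where x: "x = ((a, b), (c, d))" by (metis surj_pair)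
  show ?thesis unfolding x power2_norm_eq_inner
    by (simp add: omult_def qmult_def qconj_def oone_def inner_prod_def inner_complex_def
       complex_eq_iff scaleR_conv_of_real algebra_simps power2_eq_square)
qed

lemma left_alternative: "x \<odot> (x \<odot> y) = (x \<odot> x) \<odot> y"
proof -
  obtain a b c d a' b' c' d' where x: "x = ((a, b), (c, d))" "y = ((a', b'), (c', d'))" by (metis surj_pair)
  show ?thesis unfolding x
    by (simp add: omult_def qmult_def qconj_def algebra_simps)
qed

text \<open>An instance of right alternativity, since \<open>oconj y\<close> lies in the span of
  \<open>oone\<close> and \<open>y\<close>. It permits division by a nonzero \<open>y\<close> from
  the right without associativity.\<close>

lemma omult_oconj_omult: "(x \<odot> oconj y) \<odot> y = (norm y)\<^sup>2 *\<^sub>R x"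
proof -
  obtain a b c d a' b' c' d' where x: "x = ((a, b), (c, d))" "y = ((a', b'), (c', d'))" by (metis surj_pair)
  have *: "oconj y = ((cnj a', -b'), (-c', -d'))"
    by (simp add: x oconj_def oone_def inner_prod_def inner_complex_def complex_eq_iff)
  have n: "complex_of_real ((norm y)\<^sup>2) = a' * cnj a' + b' * cnj b' + c' * cnj c' + d' * cnj d'"
    by (simp add: x norm_prod_def flip: complex_norm_square)
  show ?thesis unfolding * scaleR_prod_def scaleR_conv_of_real n
    unfolding x
    by (simp add: omult_def qmult_def qconj_def algebra_simps)
qed

lemma norm_oconj [simp]: "norm (oconj y) = norm y"
proof -
  obtain a' b' c' d' where x: "y = ((a', b'), (c', d'))" by (metis surj_pair)
  have *: "oconj y = ((cnj a', -b'), (-c', -d'))"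
    by (simp add: x oconj_def oone_def inner_prod_def inner_complex_def complex_eq_iff)
  show ?thesis unfolding *
    unfolding x by (simp add: norm_prod_def)
qed

text \<open>Polarization of \<open>norm_omult\<close>: multiplication by a fixed octonion scales all
  inner products by the same factor.\<close>

lemma inner_omult_left: "(w \<odot> x) \<bullet> (w \<odot> y) = (norm w)\<^sup>2 * (x \<bullet> y)"
proof -
  have "(norm (w \<odot> (x + y)))\<^sup>2 = (norm w)\<^sup>2 * (norm (x + y))\<^sup>2"
       "(norm (w \<odot> x))\<^sup>2 = (norm w)\<^sup>2 * (norm x)\<^sup>2" "(norm (w \<odot> y))\<^sup>2 = (norm w)\<^sup>2 * (norm y)\<^sup>2"
    by (simp_all add: norm_omult power_mult_distrib)
  then show ?thesis
    by (simp add: omult.add_right power2_norm_eq_inner inner_commute algebra_simps)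
qed

lemma inner_omult_right: "(x \<odot> w) \<bullet> (y \<odot> w) = (norm w)\<^sup>2 * (x \<bullet> y)"
proof -
  have "(norm ((x + y) \<odot> w))\<^sup>2 = (norm w)\<^sup>2 * (norm (x + y))\<^sup>2"
       "(norm (x \<odot> w))\<^sup>2 = (norm w)\<^sup>2 * (norm x)\<^sup>2" "(norm (y \<odot> w))\<^sup>2 = (norm w)\<^sup>2 * (norm y)\<^sup>2"
    by (simp_all add: norm_omult power_mult_distrib)
  then show ?thesis
    by (simp add: omult.add_left power2_norm_eq_inner inner_commute algebra_simps)
qed

lemma omult_eq_0_iff: "x \<odot> y = 0 \<longleftrightarrow> x = 0 \<or> y = 0"
  by (metis norm_omult mult_eq_0_iff norm_eq_zero)

text \<open>Multiplicativity of the norm first gives \<open>norm J = 1\<close>; then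
  \<open>omult_self\<close> reduces the equation to a multiple of \<open>J\<close> being 0. From
  here on the imaginary units are the unit sphere of the hyperplane orthogonal to
  \<open>oone\<close>.\<close>

lemma imag_units_iff: "J \<in> imag_units \<longleftrightarrow> norm J = 1 \<and> J \<bullet> oone = 0"
proof
  assume "J \<in> imag_units"
  then have J: "J \<odot> J = - oone" by (simp add: imag_units_def)
  then have n: "norm J = 1"
    by (metis norm_omult norm_minus_cancel norm_oone norm_ge_zero abs_of_nonneg real_sqrt_abs2 real_sqrt_one)
  with J have "(2 * (J \<bullet> oone)) *\<^sub>R J = 0"
    by (simp add: omult_self)
  then have "J \<bullet> oone = 0"
    using n by auto
  with n show "norm J = 1 \<and> J \<bullet> oone = 0" by simp
qed (simp add: imag_units_def omult_self)

lemma imag_units_norm: "J \<in> imag_units \<Longrightarrow> norm J = 1"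
  and imag_units_inner: "J \<in> imag_units \<Longrightarrow> J \<bullet> oone = 0"
  by (auto simp: imag_units_iff)

lemma imag_units_omult: "J \<in> imag_units \<Longrightarrow> J \<odot> (J \<odot> x) = - x"
  by (simp add: left_alternative imag_units_def omult.minus_left)

text \<open>\<open>J\<close> acts as an isometry with square -1, and such a map is
  skew-adjoint.\<close>

lemma imag_units_skew:
  assumes "J \<in> imag_units"
  shows "(J \<odot> x) \<bullet> y = - (x \<bullet> (J \<odot> y))"
  using inner_omult_left[of J x "J \<odot> y"] assms
  by (simp add: imag_units_omult imag_units_norm)

lemma imag_units_uminus: "J \<in> imag_units \<Longrightarrow> - J \<in> imag_units"
  by (simp add: imag_units_iff)

lemma oim_inner_oone [simp]: "oim x \<bullet> oone = 0"
  by (simp add: oim_def inner_diff_left)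

lemma oim_linear_combination:
  "J \<in> imag_units \<Longrightarrow> oim (a *\<^sub>R oone + b *\<^sub>R J) = b *\<^sub>R J"
  by (simp add: oim_def inner_add_left imag_units_inner)

lemma bounded_linear_oim: "bounded_linear oim"
  unfolding oim_def by (intro bounded_linear_sub bounded_linear_ident
   bounded_linear_scaleR_const bounded_linear_inner_left)

lemma sgn_oim_imag_units: "oim x \<noteq> 0 \<Longrightarrow> sgn (oim x) \<in> imag_units"
  by (simp add: imag_units_iff norm_sgn sgn_div_norm)

text \<open>Two vectors span at most two of eight dimensions. As \<open>J\<close> is arbitrary, the
  lemma also serves to produce some imaginary unit at all.\<close>

lemma ex_imag_unit_orthogonal: "\<exists>K\<in>imag_units. K \<bullet> J = 0"
proof -
  have "dim (span {J, oone}) < DIM(octonion)"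
    using dim_le_card'[of "{J, oone}"] unfolding dim_span DIM_octonion
    by (simp add: card_insert_if split: if_splits)
  then have "dim {J, oone} < DIM(octonion)" by (simp only: dim_span)
  then obtain x where "x \<noteq> 0" and x: "\<And>y. y \<in> span {J, oone} \<Longrightarrow> orthogonal x y"
    using orthogonal_to_subspace_exists by blast
  from x have "x \<bullet> J = 0" "x \<bullet> oone = 0"
    by (auto simp: orthogonal_def span_base)
  with \<open>x \<noteq> 0\<close> have "sgn x \<in> imag_units \<and> sgn x \<bullet> J = 0"
    by (simp add: imag_units_iff norm_sgn sgn_div_norm)
  then show ?thesis by blast
qed

lemma imag_units_rotate:
  assumes "J \<in> imag_units" "v \<in> imag_units" "v \<bullet> J = 0"
  shows "cos t *\<^sub>R J + sin t *\<^sub>R v \<in> imag_units"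
proof -
  have "(norm (cos t *\<^sub>R J + sin t *\<^sub>R v))\<^sup>2 = 1"
    using assms unfolding power2_norm_eq_inner
    by (simp add: inner_add_left inner_add_right inner_commute imag_units_iff norm_eq_1
      flip: power2_eq_square)
  then have "norm (cos t *\<^sub>R J + sin t *\<^sub>R v) = 1"
    by (simp add: power2_eq_1_iff) (smt (verit) norm_ge_zero)
  then show ?thesis using assms by (simp add: imag_units_iff inner_add_left)
qed

text \<open>Angles of both signs are supplied so that even and odd parts in \<open>t\<close> can be
  separated; \<open>t < 1\<close> keeps \<open>t\<close> between 0 and pi, where the sine is
  positive.\<close>

lemma rotation_near:
  fixes J v :: octonion
  assumes "e > 0"
  obtains t :: real where "0 < t" "t < 1" "norm (cos t *\<^sub>R J + sin t *\<^sub>R v - J) < e"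
    "norm (cos (- t) *\<^sub>R J + sin (- t) *\<^sub>R v - J) < e"
proof -
  have "isCont (\<lambda>t. cos t *\<^sub>R J + sin t *\<^sub>R v) 0" by (intro continuous_intros)
  then obtain d where d: "d > 0" "\<And>t. \<bar>t\<bar> < d \<Longrightarrow> norm (cos t *\<^sub>R J + sin t *\<^sub>R v - J) < e"
    using assms unfolding continuous_at_eps_delta dist_norm by force
  show ?thesis using d(1) by (intro that[of "min (d/2) (1/2)"] d(2)) auto
qed

lemma imag_units_near:
  assumes J: "J \<in> imag_units" and e: "e > 0"
  shows "\<exists>K\<in>imag_units. K \<noteq> J \<and> norm (K - J) < e"
proof -
  obtain v where v: "v \<in> imag_units" "v \<bullet> J = 0" using ex_imag_unit_orthogonal by blast
  obtain t where t: "0 < t" "t < 1" "norm (cos t *\<^sub>R J + sin t *\<^sub>R v - J) < e"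
    using rotation_near[OF e] by metis
  have "cos t *\<^sub>R J + sin t *\<^sub>R v \<noteq> J"
  proof
    assume "cos t *\<^sub>R J + sin t *\<^sub>R v = J"
    then have "(cos t *\<^sub>R J + sin t *\<^sub>R v) \<bullet> v = J \<bullet> v" by simp
    then have "sin t = 0"
      using v by (simp add: inner_add_left imag_units_iff norm_eq_1 inner_commute[of J v]) force
    then show False using sin_gt_zero[of t] t pi_gt3 by simp
  qed
  then show ?thesis using imag_units_rotate[OF J v] t by blast
qed

text \<open>A linear functional constant on a piece of the sphere: on the great circle from
  \<open>J\<close> towards \<open>v\<close> it is
  \<open>cos t * c + sin t * (v \<bullet> a)\<close>. Comparing \<open>t\<close> with
  \<open>- t\<close> kills the sine term and leaves \<open>cos t * c = c\<close>, so
  \<open>c = 0\<close>.\<close>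

lemma inner_constant_near_imag_unit:
  assumes J: "J \<in> imag_units" and e: "e > 0"
    and c: "\<And>K. K \<in> imag_units \<Longrightarrow> norm (K - J) < e \<Longrightarrow> K \<bullet> a = c"
  shows "c = 0 \<and> oim a = 0"
proof -
  have Jc: "J \<bullet> a = c" using c[OF J] e by simp
  have key: "v \<bullet> a = 0 \<and> c = 0" if v: "v \<in> imag_units" "v \<bullet> J = 0" for v
  proof -
    obtain t where t: "0 < t" "t < 1" "norm (cos t *\<^sub>R J + sin t *\<^sub>R v - J) < e"
      "norm (cos (- t) *\<^sub>R J + sin (- t) *\<^sub>R v - J) < e"
      using rotation_near[OF e] by metis
    have "cos t * c + sin t * (v \<bullet> a) = c" "cos t * c - sin t * (v \<bullet> a) = c"
      using c[OF imag_units_rotate[OF J v] t(3)] c[OF imag_units_rotate[OF J v] t(4)]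
      by (simp_all add: inner_add_left inner_diff_left Jc)
    then have "sin t * (v \<bullet> a) = 0" "cos t * c = c" by linarith+
    moreover have "sin t > 0" using sin_gt_zero[of t] t pi_gt3 by simp
    moreover have "cos t < 1" using cos_monotone_0_pi[of 0 t] t pi_gt3 by simp
    ultimately show ?thesis by auto
  qed
  obtain v where "v \<in> imag_units" "v \<bullet> J = 0" using ex_imag_unit_orthogonal by blast
  then have c0: "c = 0" using key by blast
  moreover have "oim a = 0"
  proof (rule ccontr)
    assume n: "oim a \<noteq> 0"
    \<comment> \<open>As \<open>a\<close> is orthogonal to \<open>J\<close>, so is
      \<open>oim a\<close>; its normalization is then one of the directions \<open>v\<close> of
      \<open>key\<close>.\<close>
    have aJ: "oim a \<bullet> J = 0"
      using J Jc c0 by (simp add: oim_def inner_diff_right inner_commute[of _ J] imag_units_iff)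
    have "sgn (oim a) \<bullet> a = 0"
      using key[OF sgn_oim_imag_units[OF n]] aJ by (simp add: sgn_div_norm)
    then have "oim a \<bullet> a = 0" using n by (simp add: sgn_div_norm)
    moreover have "a = oim a + (a \<bullet> oone) *\<^sub>R oone" by (simp add: oim_def)
    ultimately have "oim a \<bullet> oim a = 0"
      by (metis inner_add_right inner_scaleR_right oim_inner_oone mult_zero_right add.right_neutral)
    with n show False by simp
  qed
  ultimately show ?thesis by simp
qed

text \<open>Replace |y|^2 z by \<open>(z \<odot> oconj y) \<odot> y\<close> and cancel the common
  right factor \<open>y\<close> with \<open>inner_omult_right\<close>.\<close>

lemma omult_adjoint: "(x \<odot> y) \<bullet> z = x \<bullet> (z \<odot> oconj y)"
proof (cases "y = 0")
  case False
  have "(norm y)\<^sup>2 * ((x \<odot> y) \<bullet> z) = (norm y)\<^sup>2 * (x \<bullet> (z \<odot> oconj y))"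
    using inner_omult_right[of x y "z \<odot> oconj y"] by (simp add: omult_oconj_omult)
  with False show ?thesis by simp
qed (simp add: omult.zero_left omult.zero_right oconj_def)

lemma inner_eq_oim: "x \<bullet> y = (x \<bullet> oone) * (y \<bullet> oone) + oim x \<bullet> oim y"
  by (simp add: oim_def inner_diff_left inner_diff_right inner_commute algebra_simps)

subsection \<open>Proper local homeomorphisms\<close>

lemma homeomorphism_imp_inj_on: "homeomorphism S T f g \<Longrightarrow> inj_on f S"
  by (rule inj_on_inverseI[of _ g]) (simp add: homeomorphism_def)

text \<open>Properness makes the fibre compact and local injectivity makes it discrete, so it is
  finite. Finitely many disjoint neighbourhoods serve as sheets, and since \<open>f\<close> is a
  closed map no further preimages appear over a small enough neighbourhood of
  \<open>y\<close>.\<close>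

lemma proper_local_homeomorphism_imp_covering_space:
  fixes f :: "'a::t2_space \<Rightarrow> 'b::topological_space"
  assumes S: "open S" and cont: "continuous_on S f"
    and proper: "proper_map (top_of_set S) (top_of_set (f ` S)) f"
    and loc: "\<And>x. x \<in> S \<Longrightarrow> \<exists>U g. open U \<and> U \<subseteq> S \<and> x \<in> U \<and> open (f ` U) \<and> homeomorphism U (f ` U) f g"
  shows "covering_space S f (f ` S)"
proof
  fix y assume y: "y \<in> f ` S"
  from loc obtain U g where U: "\<And>x. x \<in> S \<Longrightarrow> open (U x) \<and> U x \<subseteq> S \<and> x \<in> U x \<and>
      open (f ` U x) \<and> homeomorphism (U x) (f ` U x) f (g x)" by metis
  define Y where "Y = {x \<in> S. f x = y}"
  have "compactin (top_of_set S) Y"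
    using proper y by (auto simp: proper_map_def Y_def)
  then have "compact Y" by (simp add: compactin_subtopology)
  have inj: "inj_on f (U x)" if "x \<in> S" for x
    using U[OF that] homeomorphism_imp_inj_on by blast
  have Uy: "U x \<inter> Y = {x}" if "x \<in> Y" for x
    using inj[of x] U[of x] that by (auto simp: Y_def inj_on_def)
  have "finite Y"
  proof -
    from \<open>compact Y\<close> obtain C where C: "C \<subseteq> Y" "finite C" "Y \<subseteq> (\<Union>x\<in>C. U x)"
      by (rule compactE_image[of Y Y U]) (use U in \<open>auto simp: Y_def\<close>)
    have "Y \<subseteq> C"
    proof
      fix x assume "x \<in> Y"
      then obtain x' where "x' \<in> C" "x \<in> U x' \<inter> Y" using C by blast
      moreover from this have "U x' \<inter> Y = {x'}" using Uy C(1) by blast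
      ultimately show "x \<in> C" by auto
    qed
    then show ?thesis using C finite_subset by blast
  qed
  have "\<exists>W. open W \<and> x \<in> W \<and> W \<subseteq> U x" if "x \<in> Y" for x using U that by (auto simp: Y_def)
  obtain W where W: "\<And>x. x \<in> Y \<Longrightarrow> open (W x) \<and> x \<in> W x \<and> W x \<subseteq> U x"
      and disj: "\<And>x x'. x \<in> Y \<Longrightarrow> x' \<in> Y \<Longrightarrow> x \<noteq> x' \<Longrightarrow> W x \<inter> W x' = {}"
  proof -
    have "\<exists>A B. open A \<and> open B \<and> x \<in> A \<and> x' \<in> B \<and> A \<inter> B = {}" if "x \<noteq> x'" for x x' :: 'a
      using hausdorff[OF that] by blast
    then obtain A B where AB: "\<And>x x' :: 'a. x \<noteq> x' \<Longrightarrow> open (A x x') \<and> open (B x x') \<and> x \<in> A x x' \<and> x' \<in> B x x' \<and> A x x' \<inter> B x x' = {}"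
      by metis
    \<comment> \<open>The separating pairs are not chosen symmetrically, so \<open>W x\<close> takes
      the first set for the pair (x, x') and the second one for (x', x); then \<open>W x\<close>
      lies in \<open>A x x'\<close> and \<open>W x'\<close> in \<open>B x x'\<close>.\<close>
    define W where "W x = U x \<inter> (\<Inter>x'\<in>Y - {x}. A x x' \<inter> B x' x)" for x
    show ?thesis
    proof (rule that[of W])
      fix x assume x: "x \<in> Y"
      show "open (W x) \<and> x \<in> W x \<and> W x \<subseteq> U x"
      proof (intro conjI)
        have "x \<in> S" using x by (simp add: Y_def)
        have *: "open (A x x' \<inter> B x' x) \<and> x \<in> A x x' \<inter> B x' x" if "x' \<in> Y - {x}" for x'
          using AB[of x x'] AB[of x' x] that by auto
        then show "x \<in> W x" unfolding W_def using U[OF \<open>x \<in> S\<close>] by blast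
        show "open (W x)" unfolding W_def
          by (rule open_Int[OF _ open_INT]) (use * U[OF \<open>x \<in> S\<close>] \<open>finite Y\<close> in blast)+
      qed (simp add: W_def)
    next
      fix x x' assume "x \<in> Y" "x' \<in> Y" "x \<noteq> x'"
      then show "W x \<inter> W x' = {}" using AB[of x x'] by (auto simp: W_def)
    qed
  qed
  have YS: "Y \<subseteq> S" by (auto simp: Y_def)
  \<comment> \<open>What the sheets miss. Its image is relatively closed and does not contain
    \<open>y\<close>; removing it leaves a neighbourhood whose preimages all lie in the
    sheets.\<close>
  define C where "C = S - (\<Union>x\<in>Y. W x)"
  have "closedin (top_of_set S) C"
    unfolding C_def
  proof (intro closedin_diff)
    show "openin (top_of_set S) (\<Union>x\<in>Y. W x)"
    proof (rule open_subset)
      show "(\<Union>x\<in>Y. W x) \<subseteq> S" using W U YS by blast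
    qed (use W in blast)
  qed auto
  then have "closedin (top_of_set (f ` S)) (f ` C)"
    using proper by (auto simp: proper_map_def closed_map_def)
  then have opC: "openin (top_of_set (f ` S)) (f ` S - f ` C)"
    by (metis openin_diff openin_subtopology_self)
  have fW: "open (f ` W x)" if "x \<in> Y" for x
  proof -
    have "openin (top_of_set (U x)) (W x)"
      using W[OF that] by (metis open_subset)
    then have "openin (top_of_set (f ` U x)) (f ` W x)"
      using U[of x] that YS homeomorphism_imp_open_map by blast
    then show ?thesis using U[of x] that YS openin_open_trans by (metis subsetD openin_open_eq)
  qed
  define T where "T = (f ` S - f ` C) \<inter> (\<Inter>x\<in>Y. f ` W x)"
  define V where "V x = W x \<inter> f -` T" for x
  have fS: "open (f ` S)"
  proof -
    have "f ` S = (\<Union>x\<in>S. f ` U x)" using U by blast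
    then show ?thesis using U by auto
  qed
  have opT: "open T"
    unfolding T_def using fW \<open>finite Y\<close> fS openin_open_trans[OF opC] by (auto intro!: open_Int open_INT)
  show "\<exists>T. y \<in> T \<and> openin (top_of_set (f ` S)) T \<and> (\<exists>v. \<Union> v = S \<inter> f -` T \<and>
      (\<forall>u\<in>v. openin (top_of_set S) u) \<and> pairwise disjnt v \<and> (\<forall>u\<in>v. \<exists>q. homeomorphism u T f q))"
  proof (intro exI[of _ T] exI[of _ "V ` Y"] conjI ballI)
    have "y \<notin> f ` C" using W by (auto simp: C_def Y_def)
    moreover have "y \<in> f ` W x" if "x \<in> Y" for x using W[OF that] that by (auto simp: Y_def)
    ultimately show "y \<in> T" using y by (simp add: T_def)
    show "openin (top_of_set (f ` S)) T"
      using opT by (auto intro!: open_subset simp: T_def)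
    have VS: "V x \<subseteq> S" if "x \<in> Y" for x
      using that W[of x] U[of x] by (auto simp: V_def Y_def)
    have opV: "open (V x)" if "x \<in> Y" for x
    proof -
      have "open (W x)" "W x \<subseteq> S" using that W[of x] U[of x] by (auto simp: Y_def)
      then show ?thesis
        unfolding V_def using continuous_on_subset[OF cont] opT by (auto intro: continuous_open_preimage)
    qed
    show "\<Union> (V ` Y) = S \<inter> f -` T"
    proof (intro equalityI subsetI)
      fix x assume "x \<in> S \<inter> f -` T"
      moreover from this have "x \<notin> C" by (auto simp: T_def)
      ultimately show "x \<in> \<Union> (V ` Y)" by (auto simp: C_def V_def)
    qed (use VS in \<open>auto simp: V_def\<close>)
    show "pairwise disjnt (V ` Y)"
      unfolding pairwise_def disjnt_def using disj by (auto simp: V_def)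
    fix u assume "u \<in> V ` Y"
    then obtain x where x: "x \<in> Y" "u = V x" by blast
    show "openin (top_of_set S) u" using opV VS x by (simp add: open_subset)
    have "T \<subseteq> f ` W x" using x by (auto simp: T_def)
    then have "f ` V x = T" by (auto simp: V_def)
    moreover have "V x \<subseteq> U x" using W x by (auto simp: V_def)
    moreover have "homeomorphism (U x) (f ` U x) f (g x)" using U x YS by blast
    ultimately show "\<exists>q. homeomorphism u T f q"
      using x(2) homeomorphism_of_subsets[of "U x" "f ` U x" f "g x" "V x" T] by blast
  qed
qed (use cont in auto)

subsection \<open>Functions of class \<open>C\<^sup>k\<close>\<close>

lemma frechet_derivative_cong_open:
  assumes "open S" "x \<in> S" "\<And>y. y \<in> S \<Longrightarrow> f y = g y"
  shows "frechet_derivative f (at x) = frechet_derivative g (at x)"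
proof -
  have "(f has_derivative f') (at x) \<longleftrightarrow> (g has_derivative f') (at x)" for f'
    using assms has_derivative_transform_within_open[of f f' x UNIV S g]
      has_derivative_transform_within_open[of g f' x UNIV S f] by auto
  then show ?thesis unfolding frechet_derivative_def by simp
qed

lemma Ck_on_cong:
  assumes "open S" "\<And>x. x \<in> S \<Longrightarrow> f x = g x"
  shows "Ck_on k f S \<longleftrightarrow> Ck_on k g S"
  using assms(2)
proof (induction k arbitrary: f g)
  case 0
  then show ?case by (auto intro: continuous_on_cong)
next
  case (Suc k)
  have "f differentiable (at x) \<longleftrightarrow> g differentiable (at x)" if "x \<in> S" for x
    using Suc.prems that assms(1) differentiable_def has_derivative_transform_within_open
    by (smt (verit, best))
  moreover have "Ck_on k (\<lambda>x. frechet_derivative f (at x) v) S \<longleftrightarrow>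
      Ck_on k (\<lambda>x. frechet_derivative g (at x) v) S" for v
    by (rule Suc.IH) (use frechet_derivative_cong_open[OF assms(1)] Suc.prems in metis)
  ultimately show ?case by auto
qed

lemma Ck_on_subset: "Ck_on k f T \<Longrightarrow> S \<subseteq> T \<Longrightarrow> Ck_on k f S"
  by (induction k arbitrary: f) (auto intro: continuous_on_subset)

lemma Ck_on_SucD: "Ck_on (Suc k) f S \<Longrightarrow> Ck_on k f S"
proof (induction k arbitrary: f)
  case 0
  then show ?case
    by (simp add: continuous_at_imp_continuous_on differentiable_imp_continuous_within)
next
  case (Suc k)
  then show ?case by (metis Ck_on.simps(2))
qed

lemma Ck_on_imp_continuous_on: "Ck_on k f S \<Longrightarrow> continuous_on S f"
  by (induction k) (auto dest: Ck_on_SucD simp del: Ck_on.simps(2))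

text \<open>Any explicit family of derivatives may replace \<open>frechet_derivative\<close>,
  because the derivative is unique; together with \<open>Ck_on_SucE\<close> this is the form in
  which the inductions run.\<close>

lemma Ck_on_SucI:
  assumes "open S" "\<And>x. x \<in> S \<Longrightarrow> (f has_derivative f' x) (at x)"
    and "\<And>v. Ck_on k (\<lambda>x. f' x v) S"
  shows "Ck_on (Suc k) f S"
proof -
  have "f' x = frechet_derivative f (at x)" if "x \<in> S" for x
    using assms(2)[OF that] by (rule frechet_derivative_at)
  then have "Ck_on k (\<lambda>x. frechet_derivative f (at x) v) S" for v
    using assms(3)[of v] Ck_on_cong[OF assms(1), of "\<lambda>x. f' x v" "\<lambda>x. frechet_derivative f (at x) v"]
    by auto
  then show ?thesis using assms(2) by (auto simp: differentiable_def)
qed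

lemma Ck_on_SucE:
  assumes "Ck_on (Suc k) f S"
  obtains f' where "\<And>x. x \<in> S \<Longrightarrow> (f has_derivative f' x) (at x)"
    and "\<And>v. Ck_on k (\<lambda>x. f' x v) S"
  using that[of "\<lambda>x. frechet_derivative f (at x)"] assms
  unfolding Ck_on.simps frechet_derivative_works by blast

lemma Ck_on_const [intro]: "open S \<Longrightarrow> Ck_on k (\<lambda>x. c) S"
proof (induction k arbitrary: c)
  case (Suc k)
  then show ?case by (intro Ck_on_SucI[where f'="\<lambda>_ _. 0"]) auto
qed auto

lemma Ck_on_linear [intro]:
  assumes "open S" "bounded_linear f"
  shows "Ck_on k f S"
proof (cases k)
  case (Suc j)
  show ?thesis unfolding Suc
    by (rule Ck_on_SucI[where f'="\<lambda>_. f"]) (auto intro: assms bounded_linear_imp_has_derivative)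
qed (use assms linear_continuous_on in auto)

lemma Ck_on_linear_compose:
  assumes S: "open S" and h: "bounded_linear h" and f: "Ck_on k f S"
  shows "Ck_on k (\<lambda>x. h (f x)) S"
  using f
proof (induction k arbitrary: f)
  case 0
  then show ?case using bounded_linear.continuous_on[OF h] by auto
next
  case (Suc k)
  obtain f' where f': "\<And>x. x \<in> S \<Longrightarrow> (f has_derivative f' x) (at x)"
    "\<And>v. Ck_on k (\<lambda>x. f' x v) S" using Ck_on_SucE[OF Suc.prems] by blast
  show ?case
    by (rule Ck_on_SucI[OF S, where f'="\<lambda>x v. h (f' x v)"])
      (auto intro: bounded_linear.has_derivative[OF h] f' Suc.IH)
qed

lemma Ck_on_add:
  assumes S: "open S" and "Ck_on k f S" "Ck_on k g S"
  shows "Ck_on k (\<lambda>x. f x + g x) S"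
  using assms(2,3)
proof (induction k arbitrary: f g)
  case 0
  then show ?case by (auto intro: continuous_intros)
next
  case (Suc k)
  obtain f' where f': "\<And>x. x \<in> S \<Longrightarrow> (f has_derivative f' x) (at x)"
    "\<And>v. Ck_on k (\<lambda>x. f' x v) S" using Ck_on_SucE[OF Suc.prems(1)] by blast
  obtain g' where g': "\<And>x. x \<in> S \<Longrightarrow> (g has_derivative g' x) (at x)"
    "\<And>v. Ck_on k (\<lambda>x. g' x v) S" using Ck_on_SucE[OF Suc.prems(2)] by blast
  show ?case
    by (rule Ck_on_SucI[OF S, where f'="\<lambda>x v. f' x v + g' x v"])
      (auto intro: has_derivative_add f' g' Suc.IH)
qed

lemma Ck_on_sum:
  assumes "open S" "\<And>i. i \<in> I \<Longrightarrow> Ck_on k (f i) S"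
  shows "Ck_on k (\<lambda>x. \<Sum>i\<in>I. f i x) S"
  using assms(2)
  by (induction I rule: infinite_finite_induct) (auto intro: Ck_on_add Ck_on_const assms(1))

lemma Ck_on_bilinear:
  assumes S: "open S" and h: "bounded_bilinear h" and "Ck_on k f S" "Ck_on k g S"
  shows "Ck_on k (\<lambda>x. h (f x) (g x)) S"
  using assms(3,4)
proof (induction k arbitrary: f g)
  case 0
  then show ?case using bounded_bilinear.continuous_on[OF h] by auto
next
  case (Suc k)
  obtain f' where f': "\<And>x. x \<in> S \<Longrightarrow> (f has_derivative f' x) (at x)"
    "\<And>v. Ck_on k (\<lambda>x. f' x v) S" using Ck_on_SucE[OF Suc.prems(1)] by blast
  obtain g' where g': "\<And>x. x \<in> S \<Longrightarrow> (g has_derivative g' x) (at x)"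
    "\<And>v. Ck_on k (\<lambda>x. g' x v) S" using Ck_on_SucE[OF Suc.prems(2)] by blast
  show ?case
    by (rule Ck_on_SucI[OF S, where f'="\<lambda>x v. h (f x) (g' x v) + h (f' x v) (g x)"])
      (auto intro!: bounded_bilinear.FDERIV[OF h] f' g' Suc.IH Ck_on_add S
        Suc.prems[THEN Ck_on_SucD] simp del: Ck_on.simps)
qed

lemmas Ck_on_mult = Ck_on_bilinear[OF _ bounded_bilinear_mult]
lemmas Ck_on_scaleR = Ck_on_bilinear[OF _ bounded_bilinear_scaleR]
lemmas Ck_on_inner = Ck_on_bilinear[OF _ bounded_bilinear_inner]

lemma Ck_on_diff:
  assumes "open S" "Ck_on k f S" "Ck_on k g S"
  shows "Ck_on k (\<lambda>x. f x - g x) S"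
  using Ck_on_add[OF assms(1,2) Ck_on_linear_compose[OF assms(1) _ assms(3), of uminus]]
  by (simp add: bounded_linear_minus bounded_linear_ident)

lemma has_derivative_basis:
  fixes f :: "'a::euclidean_space \<Rightarrow> 'b::real_normed_vector"
  assumes "(f has_derivative f') F"
  shows "f' h = (\<Sum>b\<in>Basis. (h \<bullet> b) *\<^sub>R f' b)"
proof -
  have "linear f'" using assms by (rule has_derivative_linear)
  then show ?thesis
    by (metis (no_types, lifting) euclidean_representation linear_sum linear_scale sum.cong)
qed

text \<open>In the chain rule \<open>x\<close> enters \<open>g' (f x) (f' x v)\<close> twice.
  Expanding \<open>f' x v\<close> in the basis leaves sums of products in which \<open>g'\<close> is
  applied to fixed vectors, and to those the induction hypothesis applies.\<close>

lemma Ck_on_compose: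
  fixes f :: "'a::euclidean_space \<Rightarrow> 'b::euclidean_space" and g :: "'b \<Rightarrow> 'c::euclidean_space"
  assumes S: "open S" and T: "open T" and "Ck_on k f S" "Ck_on k g T" and fST: "f ` S \<subseteq> T"
  shows "Ck_on k (\<lambda>x. g (f x)) S"
  using assms(3,4)
proof (induction k arbitrary: g)
  case 0
  then show ?case using continuous_on_compose2[OF _ _ fST] by auto
next
  case (Suc k)
  obtain f' where f': "\<And>x. x \<in> S \<Longrightarrow> (f has_derivative f' x) (at x)"
    "\<And>v. Ck_on k (\<lambda>x. f' x v) S" using Ck_on_SucE[OF Suc.prems(1)] by blast
  obtain g' where g': "\<And>x. x \<in> T \<Longrightarrow> (g has_derivative g' x) (at x)"
    "\<And>v. Ck_on k (\<lambda>x. g' x v) T" using Ck_on_SucE[OF Suc.prems(2)] by blast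
  have "Ck_on k (\<lambda>x. \<Sum>b\<in>Basis. (f' x v \<bullet> b) *\<^sub>R g' (f x) b) S" for v
  proof (intro Ck_on_sum Ck_on_scaleR S)
    fix b :: 'b
    show "Ck_on k (\<lambda>x. f' x v \<bullet> b) S" by (intro Ck_on_inner Ck_on_const S f')
    show "Ck_on k (\<lambda>x. g' (f x) b) S" by (rule Suc.IH[OF Ck_on_SucD[OF Suc.prems(1)] g'(2)])
  qed
  moreover have "((\<lambda>x. g (f x)) has_derivative (\<lambda>v. \<Sum>b\<in>Basis. (f' x v \<bullet> b) *\<^sub>R g' (f x) b)) (at x)"
    if "x \<in> S" for x
    unfolding has_derivative_basis[OF g'(1), of "f x", symmetric, OF set_mp[OF fST imageI[OF that]]]
    using has_derivative_compose[OF f'(1)[OF that] g'(1)] that fST by (auto simp: o_def)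
  ultimately show ?case by (intro Ck_on_SucI[OF S])
qed

text \<open>Directional derivatives \<open>deriv f x * v\<close> are holomorphic again, so the
  induction closes. This is how inverses, square roots and exponentials become C^k.\<close>

lemma Ck_on_holomorphic:
  assumes "open S" "f holomorphic_on S"
  shows "Ck_on k f S"
  using assms(2)
proof (induction k arbitrary: f)
  case 0
  then show ?case by (simp add: holomorphic_on_imp_continuous_on)
next
  case (Suc k)
  show ?case
  proof (rule Ck_on_SucI[OF assms(1), where f'="\<lambda>x v. deriv f x * v"])
    fix x assume "x \<in> S"
    then show "(f has_derivative (\<lambda>v. deriv f x * v)) (at x)"
      using holomorphic_derivI[OF Suc.prems assms(1)] by (simp add: has_field_derivative_def)
  next
    fix v show "Ck_on k (\<lambda>x. deriv f x * v) S"
      by (rule Suc.IH) (intro holomorphic_intros Suc.prems assms(1))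
  qed
qed

text \<open>By the Leibniz rule the derivative of a parameter integral is a parameter integral with
  kernel \<open>K' (t, x) (0, v)\<close>. The variable t runs over all reals in the assumption
  because \<open>Ck_on\<close> is meant for open sets.\<close>

lemma Ck_on_integral:
  fixes K :: "real \<times> 'a::euclidean_space \<Rightarrow> 'b::euclidean_space"
  assumes S: "open S" "convex S" and K: "Ck_on k K (UNIV \<times> S)"
  shows "Ck_on k (\<lambda>x. integral {a..b} (\<lambda>t. K (t, x))) S"
  using K
proof (induction k arbitrary: K)
  case 0
  then have "continuous_on (S \<times> cbox a b) (\<lambda>(x, t). K (t, x))"
    unfolding case_prod_beta Ck_on.simps
    by (elim continuous_on_compose2) (auto intro!: continuous_intros)
  then show ?case using integral_continuous_on_param[of S a b "\<lambda>x t. K (t, x)"] by simp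
next
  case (Suc k)
  obtain K' where K': "\<And>x. x \<in> UNIV \<times> S \<Longrightarrow> (K has_derivative K' x) (at x)"
    "\<And>v. Ck_on k (\<lambda>x. K' x v) (UNIV \<times> S)" using Ck_on_SucE[OF Suc.prems] by blast
  define L where "L x t = Blinfun (\<lambda>h. K' (t, x) (0, h))" for x t
  have der: "((\<lambda>x. K (t, x)) has_derivative (\<lambda>h. K' (t, x) (0, h))) (at x)" if "x \<in> S" for t x
  proof -
    have "((\<lambda>x. (t, x)) has_derivative (\<lambda>h. (0, h))) (at x)"
      by (auto intro!: derivative_eq_intros)
    from has_derivative_compose[OF this K'(1)] that show ?thesis by (simp add: o_def)
  qed
  have L: "blinfun_apply (L x t) = (\<lambda>h. K' (t, x) (0, h))" if "x \<in> S" for t x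
    unfolding L_def by (rule bounded_linear_Blinfun_apply) (rule has_derivative_bounded_linear[OF der[OF that]])
  have cont: "continuous_on (S \<times> cbox a b) (\<lambda>(x, t). L x t)"
  proof (rule continuous_on_blinfun_componentwise)
    fix i :: 'a
    have "continuous_on (UNIV \<times> S) (\<lambda>z. K' z (0, i))"
      using Ck_on_imp_continuous_on[OF K'(2)] .
    then have "continuous_on (S \<times> cbox a b) (\<lambda>z. K' (snd z, fst z) (0, i))"
      by (rule continuous_on_compose2) (auto intro!: continuous_intros)
    then show "continuous_on (S \<times> cbox a b) (\<lambda>z. blinfun_apply (case z of (x, t) \<Rightarrow> L x t) i)"
      by (rule continuous_on_eq) (auto simp: L)
  qed
  have int: "(\<lambda>t. K (t, x)) integrable_on cbox a b" if "x \<in> S" for x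
  proof (intro integrable_continuous continuous_on_compose2[OF Ck_on_imp_continuous_on[OF Suc.prems]])
    show "continuous_on (cbox a b) (\<lambda>t. (t, x))" by (intro continuous_intros)
  qed (use that in auto)
  have intL: "L x integrable_on cbox a b" if "x \<in> S" for x
  proof (rule integrable_continuous)
    have "continuous_on (cbox a b) (\<lambda>t. (\<lambda>(x, t). L x t) (x, t))"
      by (rule continuous_on_compose2[OF cont]) (use that in \<open>auto intro!: continuous_intros\<close>)
    then show "continuous_on (cbox a b) (L x)" by simp
  qed
  show ?case
  proof (rule Ck_on_SucI[OF S(1)])
    fix x assume x: "x \<in> S"
    have "((\<lambda>x. integral (cbox a b) (\<lambda>t. K (t, x))) has_derivative integral (cbox a b) (L x)) (at x within S)"
      by (rule leibniz_rule[OF _ int cont x S(2)])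
        (auto simp: L intro: has_derivative_at_withinI der)
    then show "((\<lambda>x. integral {a..b} (\<lambda>t. K (t, x))) has_derivative integral (cbox a b) (L x)) (at x)"
      using at_within_open[OF x S(1)] by (simp only: cbox_interval)
  next
    fix v
    have "Ck_on k (\<lambda>x. integral {a..b} (\<lambda>t. K' (t, x) (0, v))) S"
      using Suc.IH[OF K'(2)[of "(0, v)"]] .
    then show "Ck_on k (\<lambda>x. blinfun_apply (integral (cbox a b) (L x)) v) S"
    proof (rule iffD2[OF Ck_on_cong[OF S(1)], rotated])
      fix x assume "x \<in> S"
      then show "blinfun_apply (integral (cbox a b) (L x)) v = integral {a..b} (\<lambda>t. K' (t, x) (0, v))"
        using blinfun_apply_integral[OF intL] L by (simp add: cbox_interval)
    qed
  qed
qed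

text \<open>A product rule with one factor merely continuous: a derivative of \<open>c\<close> would
  be multiplied by \<open>p a = 0\<close>. It turns continuity of the solution of a linear system
  into differentiability.\<close>

lemma has_derivative_scaleR_vanishing:
  assumes c: "isCont c a" and p: "(p has_derivative p') (at a)" and "p a = 0"
  shows "((\<lambda>x. c x *\<^sub>R p x) has_derivative (\<lambda>h. c a *\<^sub>R p' h)) (at a)"
proof -
  have lin: "bounded_linear p'" using p by (rule has_derivative_bounded_linear)
  have 1: "(\<lambda>x. c x *\<^sub>R ((p x - p a - p' (x - a)) /\<^sub>R norm (x - a))) \<midarrow>a\<rightarrow> c a *\<^sub>R 0"
    using c p by (intro tendsto_scaleR) (auto simp: isCont_def has_derivative_at_within divide_inverse_commute)
  obtain K where K: "\<And>h. norm (p' h) \<le> norm h * K" using bounded_linear.bounded[OF lin] by blast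
  have "(\<lambda>x. (c x - c a) *\<^sub>R (p' (x - a) /\<^sub>R norm (x - a))) \<midarrow>a\<rightarrow> 0"
  proof (rule Lim_null_comparison)
    show "\<forall>\<^sub>F x in at a. norm ((c x - c a) *\<^sub>R (p' (x - a) /\<^sub>R norm (x - a))) \<le> \<bar>c x - c a\<bar> * \<bar>K\<bar>"
    proof (intro always_eventually allI)
      fix x
      have "norm (p' (x - a) /\<^sub>R norm (x - a)) \<le> \<bar>K\<bar>"
        using K[of "x - a"] by (cases "x = a") (auto simp: field_simps intro: order_trans abs_ge_self)
      then show "norm ((c x - c a) *\<^sub>R (p' (x - a) /\<^sub>R norm (x - a))) \<le> \<bar>c x - c a\<bar> * \<bar>K\<bar>"
        using mult_left_mono[OF _ abs_ge_zero[of "c x - c a"]] by (simp only: norm_scaleR real_norm_def)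
    qed
    have "(\<lambda>x. \<bar>c x - c a\<bar> * \<bar>K\<bar>) \<midarrow>a\<rightarrow> \<bar>c a - c a\<bar> * \<bar>K\<bar>"
      using c by (intro tendsto_intros) (simp add: isCont_def)
    then show "(\<lambda>x. \<bar>c x - c a\<bar> * \<bar>K\<bar>) \<midarrow>a\<rightarrow> 0" by simp
  qed
  from tendsto_add[OF 1 this]
  have "(\<lambda>x. (c x *\<^sub>R p x - c a *\<^sub>R p a - c a *\<^sub>R p' (x - a)) /\<^sub>R norm (x - a)) \<midarrow>a\<rightarrow> 0"
    by (simp add: algebra_simps \<open>p a = 0\<close>)
  then show ?thesis
    using bounded_linear_compose[OF bounded_linear_scaleR_right lin] by (simp add: has_derivative_at_within)
qed

text \<open>The coefficients are frozen at \<open>a\<close>: \<open>L a (w x)\<close> equals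
  \<open>v x\<close> minus the action of \<open>L x - L a\<close> on \<open>w x\<close>, and
  \<open>M\<close> inverts \<open>L a\<close>. In the basis the error has factors
  \<open>L x b - L a b\<close> that vanish at \<open>x = a\<close>.\<close>

lemma linear_solution_perturbation:
  fixes L :: "'b::topological_space \<Rightarrow> 'a::euclidean_space \<Rightarrow> 'a"
  assumes "\<And>x. x \<in> S \<Longrightarrow> linear (L x)" "\<And>x. x \<in> S \<Longrightarrow> inj (L x)"
    and "\<And>x. x \<in> S \<Longrightarrow> L x (w x) = v x" and a: "a \<in> S"
  obtains M where "bounded_linear M" "\<And>u. L a (M u) = u"
    "\<And>x. x \<in> S \<Longrightarrow> w x = M (v x - (\<Sum>b\<in>Basis. (w x \<bullet> b) *\<^sub>R (L x b - L a b)))"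
proof -
  obtain M where M: "linear M" "M \<circ> L a = id"
    using linear_injective_left_inverse assms(1,2) a by blast
  have "L a (M u) = u" for u
    using linear_inverse_left[OF assms(1)[OF a] M(1)] M(2) by (auto simp: o_def fun_eq_iff)
  moreover have "w x = M (v x - (\<Sum>b\<in>Basis. (w x \<bullet> b) *\<^sub>R (L x b - L a b)))" if x: "x \<in> S" for x
  proof -
    have rep: "(\<Sum>b\<in>Basis. (w x \<bullet> b) *\<^sub>R L y b) = L y (w x)" if "y \<in> S" for y
      using linear_sum[OF assms(1)[OF that], of "\<lambda>b. (w x \<bullet> b) *\<^sub>R b" Basis]
      by (simp add: euclidean_representation linear_scale[OF assms(1)[OF that]])
    show ?thesis
      using M(2) assms(3)[OF x]
      by (simp add: scaleR_diff_right sum_subtractf rep a x o_def fun_eq_iff)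
  qed
  ultimately show ?thesis using that M(1) linear_conv_bounded_linear by blast
qed

lemma continuous_on_linear_solution:
  fixes L :: "'b::topological_space \<Rightarrow> 'a::euclidean_space \<Rightarrow> 'a"
  assumes "\<And>x. x \<in> S \<Longrightarrow> linear (L x)" "\<And>x. x \<in> S \<Longrightarrow> inj (L x)"
    and L: "\<And>u. continuous_on S (\<lambda>x. L x u)" and v: "continuous_on S v"
    and eq: "\<And>x. x \<in> S \<Longrightarrow> L x (w x) = v x"
  shows "continuous_on S w"
  unfolding continuous_on_def
proof
  fix a assume a: "a \<in> S"
  obtain M where M: "bounded_linear M" "\<And>u. L a (M u) = u"
    and w: "\<And>x. x \<in> S \<Longrightarrow> w x = M (v x - (\<Sum>b\<in>Basis. (w x \<bullet> b) *\<^sub>R (L x b - L a b)))"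
    using linear_solution_perturbation[where S=S and L=L and w=w and v=v, OF assms(1,2) eq a] by blast
  interpret M: bounded_linear M by fact
  obtain K where "K > 0" and K: "\<And>u. norm (M u) \<le> norm u * K" using M.pos_bounded by blast
  define \<epsilon> where "\<epsilon> x = (\<Sum>b\<in>Basis. norm (L x b - L a b))" for x
  let ?F = "at a within S"
  have L': "((\<lambda>x. L x b) \<longlongrightarrow> L a b) ?F" for b using L a by (simp add: continuous_on_def)
  have v': "(v \<longlongrightarrow> v a) ?F" using v a by (simp add: continuous_on_def)
  have "(\<epsilon> \<longlongrightarrow> (\<Sum>b\<in>Basis. norm (L a b - L a b))) ?F"
    unfolding \<epsilon>_def by (intro tendsto_intros L')
  then have \<epsilon>: "(\<epsilon> \<longlongrightarrow> 0) ?F" by simp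
  have \<epsilon>bd: "norm (\<Sum>b\<in>Basis. (u \<bullet> b) *\<^sub>R (L x b - L a b)) \<le> norm u * \<epsilon> x" for x u
    unfolding \<epsilon>_def sum_distrib_left
    by (intro order_trans[OF norm_sum] sum_mono) (auto intro!: mult_right_mono Basis_le_norm)
  \<comment> \<open>With this bound the error term is at most half of \<open>norm (w x)\<close> and
    can be absorbed, which bounds \<open>w\<close> near \<open>a\<close> before its continuity is
    known.\<close>
  have "\<forall>\<^sub>F x in ?F. \<epsilon> x < 1 / (2 * K)"
    using \<epsilon> \<open>K > 0\<close> by (intro order_tendstoD) auto
  then have bound: "\<forall>\<^sub>F x in ?F. norm (w x - w a) \<le> (norm (v x - v a) + 2 * K * norm (v x) * \<epsilon> x) * K"
    unfolding eventually_at_filter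
  proof eventually_elim
    case (elim x)
    show ?case
    proof (intro impI)
      assume "x \<noteq> a" and x: "x \<in> S"
      with elim have e: "\<epsilon> x * K \<le> 1 / 2" using \<open>K > 0\<close> by (simp add: field_simps)
      have "norm (w x) \<le> norm (v x - (\<Sum>b\<in>Basis. (w x \<bullet> b) *\<^sub>R (L x b - L a b))) * K"
        using w[OF x] K by metis
      also have "\<dots> \<le> (norm (v x) + norm (w x) * \<epsilon> x) * K"
        using \<open>K > 0\<close> \<epsilon>bd[of "w x" x] by (intro mult_right_mono order_trans[OF norm_triangle_ineq4]) auto
      also have "\<dots> \<le> norm (v x) * K + norm (w x) * (1 / 2)"
        using mult_left_mono[OF e norm_ge_zero[of "w x"]] by (simp add: algebra_simps)
      finally have wx: "norm (w x) \<le> 2 * K * norm (v x)" by (simp add: field_simps)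
      have "w a = M (v a)" using w[OF a] by simp
      then have "w x - w a = M (v x - v a - (\<Sum>b\<in>Basis. (w x \<bullet> b) *\<^sub>R (L x b - L a b)))"
        by (subst w[OF x]) (simp add: M.diff)
      then have "norm (w x - w a) \<le> norm (v x - v a - (\<Sum>b\<in>Basis. (w x \<bullet> b) *\<^sub>R (L x b - L a b))) * K"
        using K by metis
      also have "\<dots> \<le> (norm (v x - v a) + norm (w x) * \<epsilon> x) * K"
        using \<open>K > 0\<close> \<epsilon>bd[of "w x" x] by (intro mult_right_mono order_trans[OF norm_triangle_ineq4]) auto
      also have "\<dots> \<le> (norm (v x - v a) + 2 * K * norm (v x) * \<epsilon> x) * K"
        using \<open>K > 0\<close> wx by (intro mult_right_mono add_left_mono) (auto simp: \<epsilon>_def sum_nonneg)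
      finally show "norm (w x - w a) \<le> (norm (v x - v a) + 2 * K * norm (v x) * \<epsilon> x) * K" .
    qed
  qed
  have "((\<lambda>x. (norm (v x - v a) + 2 * K * norm (v x) * \<epsilon> x) * K) \<longlongrightarrow>
      (norm (v a - v a) + 2 * K * norm (v a) * 0) * K) ?F"
    by (intro tendsto_intros v' \<epsilon>)
  then have "((\<lambda>x. w x - w a) \<longlongrightarrow> 0) ?F"
    by (intro Lim_null_comparison[OF bound]) simp
  then show "(w \<longlongrightarrow> w a) ?F" by (simp add: LIM_zero_iff)
qed

text \<open>Differentiating \<open>L x (w x) = v x\<close> gives a system for \<open>w' x h\<close>
  with the same operators and a right-hand side in which \<open>w\<close> occurs undifferentiated.
  Once \<open>w\<close> is C^k, the induction hypothesis with a new \<open>v\<close> shows that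
  \<open>w'\<close> is C^k too.\<close>

lemma Ck_on_linear_solution:
  fixes L :: "'b::euclidean_space \<Rightarrow> 'a::euclidean_space \<Rightarrow> 'a"
  assumes S: "open S" and lin: "\<And>x. x \<in> S \<Longrightarrow> linear (L x)" "\<And>x. x \<in> S \<Longrightarrow> inj (L x)"
    and L: "\<And>u. Ck_on k (\<lambda>x. L x u) S" and v: "Ck_on k v S"
    and eq: "\<And>x. x \<in> S \<Longrightarrow> L x (w x) = v x"
  shows "Ck_on k w S"
  using L v eq
proof (induction k arbitrary: v w)
  case 0
  then show ?case using continuous_on_linear_solution[where S=S and L=L and w=w and v=v, OF lin] by auto
next
  case (Suc k)
  have wk: "Ck_on k w S" by (rule Suc.IH[OF Ck_on_SucD[OF Suc.prems(1)] Ck_on_SucD[OF Suc.prems(2)] Suc.prems(3)])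
  obtain v' where v': "\<And>x. x \<in> S \<Longrightarrow> (v has_derivative v' x) (at x)"
    "\<And>h. Ck_on k (\<lambda>x. v' x h) S" using Ck_on_SucE[OF Suc.prems(2)] by blast
  have "\<exists>L'. (\<forall>x\<in>S. ((\<lambda>x. L x u) has_derivative L' x) (at x)) \<and> (\<forall>h. Ck_on k (\<lambda>x. L' x h) S)" for u
    using Ck_on_SucE[OF Suc.prems(1)[of u]] by metis
  then obtain L' where L': "\<And>u x. x \<in> S \<Longrightarrow> ((\<lambda>x. L x u) has_derivative L' u x) (at x)"
    "\<And>u h. Ck_on k (\<lambda>x. L' u x h) S" by metis
  define r where "r x h = v' x h - (\<Sum>b\<in>Basis. (w x \<bullet> b) *\<^sub>R L' b x h)" for x h
  have rk: "Ck_on k (\<lambda>x. r x h) S" for h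
    unfolding r_def
    by (intro Ck_on_diff Ck_on_sum Ck_on_scaleR Ck_on_inner Ck_on_const S v' L' wk)
  have "\<exists>w'. (w has_derivative w') (at x) \<and> (\<forall>h. L x (w' h) = r x h)" if x: "x \<in> S" for x
  proof -
    obtain M where M: "bounded_linear M" "\<And>u. L x (M u) = u"
      and w: "\<And>y. y \<in> S \<Longrightarrow> w y = M (v y - (\<Sum>b\<in>Basis. (w y \<bullet> b) *\<^sub>R (L y b - L x b)))"
      using linear_solution_perturbation[where S=S and L=L and w=w and v=v, OF lin Suc.prems(3) x] by blast
    have wc: "isCont w x"
      using Ck_on_imp_continuous_on[OF wk] S x by (simp add: continuous_on_eq_continuous_at)
    have "((\<lambda>y. (w y \<bullet> b) *\<^sub>R (L y b - L x b)) has_derivative (\<lambda>h. (w x \<bullet> b) *\<^sub>R L' b x h)) (at x)" for b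
    proof (rule has_derivative_scaleR_vanishing)
      show "((\<lambda>y. L y b - L x b) has_derivative (\<lambda>h. L' b x h)) (at x)"
        using has_derivative_diff[OF L'(1)[OF x] has_derivative_const] by simp
    qed (use wc in \<open>auto intro: continuous_intros\<close>)
    then have "((\<lambda>y. M (v y - (\<Sum>b\<in>Basis. (w y \<bullet> b) *\<^sub>R (L y b - L x b)))) has_derivative (\<lambda>h. M (r x h))) (at x)"
      unfolding r_def
      by (intro bounded_linear.has_derivative[OF M(1)] has_derivative_diff v'(1)[OF x] has_derivative_sum)
    then have "(w has_derivative (\<lambda>h. M (r x h))) (at x)"
      by (rule has_derivative_transform_within_open[OF _ S x]) (use w in auto)
    then show ?thesis using M(2) by blast
  qed
  then obtain w' where w': "\<And>x. x \<in> S \<Longrightarrow> (w has_derivative w' x) (at x)"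
    "\<And>x h. x \<in> S \<Longrightarrow> L x (w' x h) = r x h" by metis
  show ?case
  proof (rule Ck_on_SucI[OF S w'(1)])
    fix h show "Ck_on k (\<lambda>x. w' x h) S"
      by (rule Suc.IH[OF Ck_on_SucD[OF Suc.prems(1)] rk w'(2)])
  qed
qed

text \<open>Bootstrapping: the inverse \<open>g\<close> is differentiable with
  \<open>f' (g y) (g' y v) = v\<close>. If \<open>g\<close> is C^k, so are the coefficients of this
  linear system, hence its solution \<open>g'\<close>, and \<open>g\<close> is C^(k+1).\<close>

lemma smooth_inverse_function_theorem:
  fixes f :: "'a::euclidean_space \<Rightarrow> 'a"
  assumes S: "open S" and f: "smooth_on f S" and a: "a \<in> S" and bij: "bij (frechet_derivative f (at a))"
  obtains U where "open U" "U \<subseteq> S" "a \<in> U" "diffeomorphism U (f ` U) f"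
    "homeomorphism U (f ` U) f (inv_into U f)"
proof -
  define f' where "f' x = frechet_derivative f (at x)" for x
  have der: "(f has_derivative f' x) (at x)" if "x \<in> S" for x
    using f that unfolding smooth_on_def f'_def by (metis Ck_on.simps(2) frechet_derivative_works)
  have f'k: "Ck_on k (\<lambda>x. f' x v) S" for k v
    using f unfolding smooth_on_def f'_def by (metis Ck_on.simps(2))
  have bl: "blinfun_apply (Blinfun (f' x)) = f' x" if "x \<in> S" for x
    using has_derivative_bounded_linear[OF der[OF that]] by (rule bounded_linear_Blinfun_apply)
  obtain M where M: "linear M" "M \<circ> f' a = id"
    using linear_injective_left_inverse[of "f' a"] bij has_derivative_linear[OF der[OF a]]
    by (auto simp: bij_def f'_def)
  have cont: "continuous_on S (\<lambda>x. Blinfun (f' x))"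
  proof (rule continuous_on_blinfun_componentwise)
    fix i
    show "continuous_on S (\<lambda>x. blinfun_apply (Blinfun (f' x)) i)"
      using Ck_on_imp_continuous_on[OF f'k[of 0 i]] by (rule continuous_on_eq) (simp add: bl)
  qed
  have id: "Blinfun M o\<^sub>L Blinfun (f' a) = id_blinfun"
    using M by (intro blinfun_eqI) (simp add: bl a bounded_linear_Blinfun_apply linear_conv_bounded_linear fun_eq_iff)
  have der': "(f has_derivative blinfun_apply (Blinfun (f' x))) (at x)" if "x \<in> S" for x
    using der[OF that] bl[OF that] by simp
  obtain U V g g' where UV: "open U" "U \<subseteq> S" "a \<in> U" "open V" "f a \<in> V" "homeomorphism U V f g"
    and g': "\<And>y. y \<in> V \<Longrightarrow> (g has_derivative g' y) (at y)"
    "\<And>y. y \<in> V \<Longrightarrow> g' y = inv (blinfun_apply (Blinfun (f' (g y))))"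
    "\<And>y. y \<in> V \<Longrightarrow> bij (blinfun_apply (Blinfun (f' (g y))))"
    using inverse_function_theorem[OF S der' cont a id] by blast
  have V: "V = f ` U" using UV(6) by (simp add: homeomorphism_def)
  have gV: "g ` V \<subseteq> U" using UV(6) by (simp add: homeomorphism_def)
  have inj: "inj_on f U" using UV(6) homeomorphism_imp_inj_on by blast
  have g_inv: "g y = inv_into U f y" if "y \<in> V" for y
    using UV(6) that inj unfolding homeomorphism_def by (metis image_eqI inv_into_f_eq)
  have "Ck_on k g V" for k
  proof (induction k)
    case 0
    then show ?case using UV(6) by (simp add: homeomorphism_def)
  next
    case (Suc k)
    show ?case
    proof (rule Ck_on_SucI[OF UV(4) g'(1)])
      fix v
      show "Ck_on k (\<lambda>y. g' y v) V"
      proof (rule Ck_on_linear_solution[OF UV(4), where L="\<lambda>y. f' (g y)" and v="\<lambda>_. v"])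
        fix y assume y: "y \<in> V"
        then have gy: "g y \<in> S" using gV UV(2) by auto
        show "linear (f' (g y))" using has_derivative_linear[OF der[OF gy]] .
        show "inj (f' (g y))" using g'(3)[OF y] by (simp add: bl gy bij_def)
        show "f' (g y) (g' y v) = v" using g'(2,3)[OF y] by (simp add: bl gy surj_f_inv_f bij_is_surj)
      next
        fix u show "Ck_on k (\<lambda>y. f' (g y) u) V"
          by (rule Ck_on_compose[OF UV(4) S Suc f'k]) (use gV UV(2) in auto)
      qed (simp add: Ck_on_const UV(4))
    qed
  qed
  then have "smooth_on (inv_into U f) V"
    unfolding smooth_on_def using Ck_on_cong[OF UV(4), of g "inv_into U f"] g_inv by auto
  moreover have "smooth_on f U" using f Ck_on_subset UV(2) unfolding smooth_on_def by blast
  ultimately have "diffeomorphism U (f ` U) f"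
    unfolding diffeomorphism_def using UV(1,4) inj by (simp add: V bij_betw_def)
  moreover have "homeomorphism U (f ` U) f (inv_into U f)"
    using homeomorphism_cong[OF UV(6), of U V f "inv_into U f"] g_inv by (simp add: V)
  ultimately show ?thesis using that UV(1-3) by blast
qed

subsection \<open>Slice functions and the normal function\<close>

definition point :: "complex \<Rightarrow> octonion \<Rightarrow> octonion" where
  "point z J = Re z *\<^sub>R oone + Im z *\<^sub>R J"

text \<open>Of the two conjugate numbers that describe a sphere, the one with nonnegative imaginary
  part is taken; this choice is continuous everywhere but differentiable only off the real
  axis.\<close>

definition zcoord :: "octonion \<Rightarrow> complex" where
  "zcoord x = Complex (x \<bullet> oone) (norm (oim x))"

lemma zcoord_point: "J \<in> imag_units \<Longrightarrow> zcoord (point z J) = Complex (Re z) \<bar>Im z\<bar>"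
  by (simp add: zcoord_def point_def oim_linear_combination imag_units_norm inner_add_left imag_units_inner)

text \<open>For real \<open>x\<close> the second argument is \<open>sgn 0 = 0\<close>, not an
  imaginary unit, but its coefficient vanishes as well; \<open>ex_point\<close> supplies a genuine
  unit.\<close>

lemma point_zcoord: "x = point (zcoord x) (sgn (oim x))"
proof -
  have "norm (oim x) *\<^sub>R sgn (oim x) = oim x" by (cases "oim x = 0") (simp_all add: sgn_div_norm)
  then show ?thesis by (simp add: zcoord_def point_def) (simp add: oim_def)
qed

lemma ex_point:
  obtains J where "J \<in> imag_units" "x = point (zcoord x) J"
proof (cases "oim x = 0")
  case True
  obtain J where "J \<in> imag_units" using ex_imag_unit_orthogonal by blast
  moreover have "x = point (zcoord x) J"
    using point_zcoord[of x] True by (simp add: point_def zcoord_def)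
  ultimately show ?thesis using that by blast
qed (use that sgn_oim_imag_units point_zcoord in blast)

lemma norm_point_diff:
  assumes "J \<in> imag_units"
  shows "norm (point z J - point w J) = cmod (z - w)"
proof -
  have "(norm (point z J - point w J))\<^sup>2 = (cmod (z - w))\<^sup>2"
  proof -
    have *: "point z J - point w J = (Re z - Re w) *\<^sub>R oone + (Im z - Im w) *\<^sub>R J"
      by (simp add: point_def algebra_simps)
    show ?thesis
      unfolding * power2_norm_eq_inner using assms
      by (simp add: inner_add_left inner_add_right imag_units_iff norm_eq_1 inner_commute
        inner_complex_def)
  qed
  then show ?thesis by simp
qed

lemma continuous_on_zcoord: "continuous_on S zcoord"
proof -
  have "continuous_on S oim" using bounded_linear_oim by (simp add: linear_continuous_on)
  then show ?thesis unfolding zcoord_def[abs_def] Complex_eq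
    by (intro continuous_intros)
qed

text \<open>Conjugation invariance allows the sign of \<beta> to be absorbed into \<open>J\<close>.
  As a preimage under the continuous \<open>zcoord\<close>, the set is visibly open for open
  \<open>D\<close>.\<close>

lemma circular_set_eq:
  assumes "conj_invariant D"
  shows "circular_set D = zcoord -` D"
proof (intro equalityI subsetI)
  fix x assume "x \<in> circular_set D"
  then obtain \<alpha> \<beta> J where x: "x = point (Complex \<alpha> \<beta>) J" "J \<in> imag_units" "Complex \<alpha> \<beta> \<in> D"
    by (auto simp: circular_set_def point_def)
  have "Complex \<alpha> \<bar>\<beta>\<bar> \<in> {Complex \<alpha> \<beta>, cnj (Complex \<alpha> \<beta>)}" by (auto simp: complex_eq_iff)
  with x assms show "x \<in> zcoord -` D" by (auto simp: zcoord_point conj_invariant_def)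
next
  fix x assume "x \<in> zcoord -` D"
  then have "Complex (Re (zcoord x)) (Im (zcoord x)) \<in> D" by simp
  moreover obtain J where "J \<in> imag_units" "x = Re (zcoord x) *\<^sub>R oone + Im (zcoord x) *\<^sub>R J"
    using ex_point[of x] unfolding point_def by metis
  ultimately show "x \<in> circular_set D" unfolding circular_set_def by blast
qed

lemma has_derivative_zcoord:
  assumes "oim x \<noteq> 0"
  shows "(zcoord has_derivative (\<lambda>h. Complex (h \<bullet> oone) (sgn (oim x) \<bullet> oim h))) (at x)"
proof -
  have "((\<lambda>x. norm (oim x)) has_derivative (\<lambda>h. sgn (oim x) \<bullet> oim h)) (at x)"
    using has_derivative_compose[OF bounded_linear_imp_has_derivative[OF bounded_linear_oim]
        has_derivative_norm[OF assms]] by (simp add: inner_commute)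
  then show ?thesis unfolding zcoord_def[abs_def] Complex_eq
    by (auto intro!: derivative_eq_intros)
qed

text \<open>\<open>P\<close> and \<open>Q\<close> are the components of the stem function,
  \<open>A\<close> and \<open>B\<close> those of its complex derivative: the shape of
  \<open>P_deriv\<close> and \<open>Q_deriv\<close> encodes the Cauchy-Riemann equations.\<close>

locale stem =
  fixes D :: "complex set" and P Q A B :: "complex \<Rightarrow> octonion"
  assumes open_D: "open D" and conj_D: "\<And>z. z \<in> D \<Longrightarrow> cnj z \<in> D"
    and P_cnj: "\<And>z. z \<in> D \<Longrightarrow> P (cnj z) = P z"
    and Q_cnj: "\<And>z. z \<in> D \<Longrightarrow> Q (cnj z) = - Q z"
    and P_deriv: "\<And>z. z \<in> D \<Longrightarrow> (P has_derivative (\<lambda>h. Re h *\<^sub>R A z - Im h *\<^sub>R B z)) (at z)"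
    and Q_deriv: "\<And>z. z \<in> D \<Longrightarrow> (Q has_derivative (\<lambda>h. Re h *\<^sub>R B z + Im h *\<^sub>R A z)) (at z)"
    and cont_A: "continuous_on D A" and cont_B: "continuous_on D B"
begin

lemma cont_P: "continuous_on D P" and cont_Q: "continuous_on D Q"
  by (auto intro!: continuous_at_imp_continuous_on intro: has_derivative_continuous P_deriv Q_deriv)

lemma A_B_cnj:
  assumes z: "z \<in> D"
  shows "A (cnj z) = A z" "B (cnj z) = - B z"
proof -
  have "((\<lambda>w. P (cnj w)) has_derivative (\<lambda>h. Re h *\<^sub>R A (cnj z) + Im h *\<^sub>R B (cnj z))) (at z)"
    using has_derivative_compose[OF bounded_linear_imp_has_derivative[OF bounded_linear_cnj] P_deriv[OF conj_D[OF z]]]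
    by simp
  then have "(P has_derivative (\<lambda>h. Re h *\<^sub>R A (cnj z) + Im h *\<^sub>R B (cnj z))) (at z)"
    by (rule has_derivative_transform_within_open[OF _ open_D z]) (simp add: P_cnj)
  from has_derivative_unique[OF this P_deriv[OF z]]
  have *: "Re h *\<^sub>R A (cnj z) + Im h *\<^sub>R B (cnj z) = Re h *\<^sub>R A z - Im h *\<^sub>R B z" for h by metis
  show "A (cnj z) = A z" "B (cnj z) = - B z" using *[of 1] *[of \<i>] by simp_all
qed

lemma real_point:
  assumes "z \<in> D" "Im z = 0"
  shows "Q z = 0" "B z = 0"
proof -
  have "cnj z = z" using assms by (simp add: complex_eq_iff)
  then have "Q z = - Q z" "B z = - B z" using Q_cnj[OF assms(1)] A_B_cnj(2)[OF assms(1)] by simp_all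
  then show "Q z = 0" "B z = 0" by (metis eq_neg_iff_add_eq_0 scaleR_2 scaleR_eq_0_iff zero_neq_numeral)+
qed

text \<open>
  \<open>N q\<close> is the sum of the squares of the eight complex components of \<open>F - q\<close>, where
  \<open>F = P + \<iota> Q\<close>, that is the normal function of \<open>f - q\<close>.
\<close>

definition N :: "octonion \<Rightarrow> complex \<Rightarrow> complex" where
  "N q z = Complex ((norm (P z - q))\<^sup>2 - (norm (Q z))\<^sup>2) (2 * ((P z - q) \<bullet> Q z))"

text \<open>Twice the complex-bilinear product of \<open>F - q\<close> with the derivative of
  \<open>F\<close>, as results from differentiating a sum of squares.\<close>

definition Nd :: "octonion \<Rightarrow> complex \<Rightarrow> complex" where
  "Nd q z = 2 * Complex ((P z - q) \<bullet> A z - Q z \<bullet> B z) ((P z - q) \<bullet> B z + Q z \<bullet> A z)"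

lemma N_deriv:
  assumes z: "z \<in> D"
  shows "(N q has_field_derivative Nd q z) (at z)"
proof -
  have "((\<lambda>z. of_real ((P z - q) \<bullet> (P z - q) - Q z \<bullet> Q z) + \<i> * of_real (2 * ((P z - q) \<bullet> Q z)))
      has_derivative (\<lambda>h. Nd q z * h)) (at z)"
    by (auto intro!: derivative_eq_intros P_deriv[OF z] Q_deriv[OF z]
      simp: fun_eq_iff complex_eq_iff Nd_def inner_commute inner_diff_left inner_diff_right
        inner_add_left inner_add_right algebra_simps)
  then show ?thesis
    unfolding has_field_derivative_def N_def[abs_def] power2_norm_eq_inner Complex_eq .
qed

lemma N_holomorphic: "S \<subseteq> D \<Longrightarrow> N q holomorphic_on S"
  unfolding holomorphic_on_def field_differentiable_def
  using N_deriv has_field_derivative_at_within by blast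

lemma N_cnj: "z \<in> D \<Longrightarrow> N q (cnj z) = cnj (N q z)"
  by (simp add: N_def P_cnj Q_cnj complex_eq_iff)

lemma Nd_cnj: "z \<in> D \<Longrightarrow> Nd q (cnj z) = cnj (Nd q z)"
  by (simp add: Nd_def P_cnj Q_cnj A_B_cnj complex_eq_iff)

lemma N_preimage: "J \<in> imag_units \<Longrightarrow> N (P z + J \<odot> Q z) z = 0"
  using imag_units_skew[of J "Q z" "Q z"]
  by (simp add: N_def norm_omult imag_units_norm complex_eq_iff inner_commute)

text \<open>\<open>N q z = 0\<close> says that \<open>P z - q\<close> and \<open>Q z\<close> are
  orthogonal and of equal length. For nonzero \<open>Q z\<close>, dividing \<open>q - P z\<close> by
  it from the right then gives an octonion of norm 1 orthogonal to \<open>oone\<close>.\<close>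

lemma N_eq_0_imp_preimage:
  assumes N: "N q z = 0"
  shows "\<exists>J\<in>imag_units. P z + J \<odot> Q z = q"
proof (cases "Q z = 0")
  case True
  obtain J where "J \<in> imag_units" using ex_imag_unit_orthogonal by blast
  moreover have "P z + J \<odot> Q z = q" using N True by (simp add: N_def complex_eq_iff omult.zero_right)
  ultimately show ?thesis by blast
next
  case False
  define J where "J = ((q - P z) \<odot> oconj (Q z)) /\<^sub>R (norm (Q z))\<^sup>2"
  have JQ: "J \<odot> Q z = q - P z"
    using False by (simp add: J_def omult.scaleR_left omult_oconj_omult)
  have "(norm (P z - q))\<^sup>2 = (norm (Q z))\<^sup>2" and orth: "(P z - q) \<bullet> Q z = 0"
    using N by (simp_all add: N_def complex_eq_iff)
  then have "norm (q - P z) = norm (Q z)" by (simp add: norm_minus_commute)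
  then have "norm J = 1" using False JQ norm_omult[of J "Q z"] by simp
  moreover have "J \<bullet> oone = 0"
  proof -
    have "(q - P z) \<bullet> Q z = 0" using orth by (simp add: inner_diff_left)
    then show ?thesis using inner_omult_right[of J "Q z" oone] False by (simp add: JQ)
  qed
  ultimately show ?thesis by (intro bexI[of _ J]) (simp_all add: imag_units_iff JQ)
qed

lemma Nd_preimage:
  "Nd (P z + J \<odot> Q z) z =
    2 * Complex (- ((J \<odot> Q z) \<bullet> A z) - Q z \<bullet> B z) (Q z \<bullet> A z - (J \<odot> Q z) \<bullet> B z)"
  by (simp add: Nd_def complex_eq_iff)

text \<open>The factor \<open>norm (Q z)\<close> is the point: near a real point it is at most of
  the order of \<open>Im z\<close>, like the distance between the two conjugate zeros.\<close>

lemma norm_Nd_preimage_le: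
  assumes "J \<in> imag_units"
  shows "norm (Nd (P z + J \<odot> Q z) z) \<le> 4 * norm (Q z) * (norm (A z) + norm (B z))"
proof -
  have *: "\<bar>(J \<odot> Q z) \<bullet> u\<bar> \<le> norm (Q z) * norm u" "\<bar>Q z \<bullet> u\<bar> \<le> norm (Q z) * norm u" for u
    using Cauchy_Schwarz_ineq2[of "J \<odot> Q z" u] Cauchy_Schwarz_ineq2[of "Q z" u] assms
    by (simp_all add: norm_omult imag_units_norm)
  have "norm (Nd (P z + J \<odot> Q z) z) \<le>
    2 * (\<bar>- ((J \<odot> Q z) \<bullet> A z) - Q z \<bullet> B z\<bar> + \<bar>Q z \<bullet> A z - (J \<odot> Q z) \<bullet> B z\<bar>)"
    using cmod_le[of "Complex (- ((J \<odot> Q z) \<bullet> A z) - Q z \<bullet> B z) (Q z \<bullet> A z - (J \<odot> Q z) \<bullet> B z)"]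
    by (simp add: Nd_preimage norm_mult)
  also have "\<dots> \<le> 4 * norm (Q z) * (norm (A z) + norm (B z))"
    using *[of "A z"] *[of "B z"] abs_triangle_ineq4[of "- ((J \<odot> Q z) \<bullet> A z)" "Q z \<bullet> B z"]
      abs_triangle_ineq4[of "Q z \<bullet> A z" "(J \<odot> Q z) \<bullet> B z"] by (simp only: distrib_left abs_minus_cancel)
  finally show ?thesis .
qed

text \<open>Through \<open>omult_adjoint\<close> the two components of \<open>Nd\<close> become
  linear functionals of \<open>K\<close> that are constant near \<open>J\<close>. The constant for
  \<open>A\<close> is \<open>- (Q z \<bullet> B z)\<close> and the one for \<open>B\<close> is
  \<open>Q z \<bullet> A z\<close>, so the vanishing of each supplies the real part that the other
  still lacks.\<close>

lemma A_B_eq_0_if_Nd_eq_0_near: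
  assumes J: "J \<in> imag_units" and e: "e > 0" and Q: "Q z \<noteq> 0"
    and Nd: "\<And>K. K \<in> imag_units \<Longrightarrow> norm (K - J) < e \<Longrightarrow> Nd (P z + K \<odot> Q z) z = 0"
  shows "A z = 0" "B z = 0"
proof -
  have main: "u = 0" if "Q z \<bullet> u = 0" "oim (u \<odot> oconj (Q z)) = 0" for u
  proof -
    have "(u \<odot> oconj (Q z)) \<bullet> oone = 0"
      using that(1) omult_adjoint[of oone "Q z" u] by (simp add: inner_commute)
    then have "u \<odot> oconj (Q z) = 0" using that(2) by (simp add: oim_def)
    then show "u = 0" using Q by (metis omult_eq_0_iff norm_oconj norm_eq_zero)
  qed
  have "- ((K \<odot> Q z) \<bullet> A z) = Q z \<bullet> B z \<and> (K \<odot> Q z) \<bullet> B z = Q z \<bullet> A z"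
    if "K \<in> imag_units" "norm (K - J) < e" for K
    using Nd[OF that] by (simp add: Nd_preimage complex_eq_iff)
  then have *: "K \<bullet> (A z \<odot> oconj (Q z)) = - (Q z \<bullet> B z)" "K \<bullet> (B z \<odot> oconj (Q z)) = Q z \<bullet> A z"
    if "K \<in> imag_units" "norm (K - J) < e" for K
    unfolding omult_adjoint[symmetric] using that by fastforce+
  show "A z = 0" "B z = 0"
    using inner_constant_near_imag_unit[OF J e *(1)] inner_constant_near_imag_unit[OF J e *(2)] main by auto
qed

end

section \<open>The real differential of a slice function\<close>

locale slice_function = stem +
  fixes f :: "octonion \<Rightarrow> octonion"
  assumes f_point: "\<And>z J. z \<in> D \<Longrightarrow> J \<in> imag_units \<Longrightarrow> f (point z J) = P z + J \<odot> Q z"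
begin

text \<open>At a real point \<open>sgn\<close> is 0 rather than an imaginary unit, but there
  \<open>Q\<close> vanishes, so one formula covers all points.\<close>

lemma f_eq: "zcoord x \<in> D \<Longrightarrow> f x = P (zcoord x) + sgn (oim x) \<odot> Q (zcoord x)"
proof (cases "oim x = 0")
  case True
  assume z: "zcoord x \<in> D"
  obtain J where "J \<in> imag_units" "x = point (zcoord x) J" by (rule ex_point)
  moreover have "Q (zcoord x) = 0" using True by (intro real_point z) (simp add: zcoord_def)
  ultimately show ?thesis using f_point[OF z, of J] by (simp add: omult.zero_right)
qed (use f_point sgn_oim_imag_units point_zcoord in metis)

text \<open>The terms belong to the real direction, the direction \<open>J\<close> inside the slice,
  and the directions tangent to the sphere through \<open>x\<close>, on which \<open>f\<close> is
  affine in the imaginary unit.\<close>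

lemma has_derivative_nonreal:
  assumes z: "zcoord x \<in> D" and x: "oim x \<noteq> 0"
  defines "J \<equiv> sgn (oim x)"
  shows "(f has_derivative (\<lambda>h. (h \<bullet> oone) *\<^sub>R (A (zcoord x) + J \<odot> B (zcoord x)) +
      (J \<bullet> oim h) *\<^sub>R (J \<odot> A (zcoord x) - B (zcoord x)) +
      (oim h - (J \<bullet> oim h) *\<^sub>R J) \<odot> (Q (zcoord x) /\<^sub>R norm (oim x)))) (at x)"
proof -
  have oim: "(oim has_derivative oim) (at x)"
    using bounded_linear_oim by (rule bounded_linear_imp_has_derivative)
  have n: "((\<lambda>x. inverse (norm (oim x))) has_derivative
      (\<lambda>h. - (inverse (norm (oim x)) * (J \<bullet> oim h) * inverse (norm (oim x))))) (at x)"
    using Deriv.has_derivative_inverse[OF _ has_derivative_compose[OF oim has_derivative_norm[OF x]]] x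
    by (simp add: J_def inner_commute)
  have P: "((\<lambda>x. P (zcoord x)) has_derivative (\<lambda>h. (h \<bullet> oone) *\<^sub>R A (zcoord x) - (J \<bullet> oim h) *\<^sub>R B (zcoord x))) (at x)"
    and Q: "((\<lambda>x. Q (zcoord x)) has_derivative (\<lambda>h. (h \<bullet> oone) *\<^sub>R B (zcoord x) + (J \<bullet> oim h) *\<^sub>R A (zcoord x))) (at x)"
    using has_derivative_compose[OF has_derivative_zcoord[OF x] P_deriv[OF z]]
      has_derivative_compose[OF has_derivative_zcoord[OF x] Q_deriv[OF z]] by (simp_all add: J_def)
  have "((\<lambda>x. P (zcoord x) + inverse (norm (oim x)) *\<^sub>R (oim x \<odot> Q (zcoord x))) has_derivative
     (\<lambda>h. (h \<bullet> oone) *\<^sub>R A (zcoord x) - (J \<bullet> oim h) *\<^sub>R B (zcoord x) +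
       (inverse (norm (oim x)) *\<^sub>R (oim x \<odot> ((h \<bullet> oone) *\<^sub>R B (zcoord x) + (J \<bullet> oim h) *\<^sub>R A (zcoord x))
         + oim h \<odot> Q (zcoord x))
       + (- (inverse (norm (oim x)) * (J \<bullet> oim h) * inverse (norm (oim x)))) *\<^sub>R (oim x \<odot> Q (zcoord x))))) (at x)"
    by (intro has_derivative_add P has_derivative_scaleR n omult.FDERIV oim Q)
  also have "(\<lambda>h. (h \<bullet> oone) *\<^sub>R A (zcoord x) - (J \<bullet> oim h) *\<^sub>R B (zcoord x) +
       (inverse (norm (oim x)) *\<^sub>R (oim x \<odot> ((h \<bullet> oone) *\<^sub>R B (zcoord x) + (J \<bullet> oim h) *\<^sub>R A (zcoord x))
         + oim h \<odot> Q (zcoord x))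
       + (- (inverse (norm (oim x)) * (J \<bullet> oim h) * inverse (norm (oim x)))) *\<^sub>R (oim x \<odot> Q (zcoord x)))) =
    (\<lambda>h. (h \<bullet> oone) *\<^sub>R (A (zcoord x) + J \<odot> B (zcoord x)) +
      (J \<bullet> oim h) *\<^sub>R (J \<odot> A (zcoord x) - B (zcoord x)) +
      (oim h - (J \<bullet> oim h) *\<^sub>R J) \<odot> (Q (zcoord x) /\<^sub>R norm (oim x)))"
  proof
    fix h
    define n where "n = norm (oim x)"
    have "n \<noteq> 0" and o: "oim x = n *\<^sub>R J" using x by (simp_all add: n_def J_def sgn_div_norm)
    then have n: "inverse n * (c * n) = c" "inverse n * c * inverse n * n = inverse n * c" for c
      by simp_all
    show "(h \<bullet> oone) *\<^sub>R A (zcoord x) - (J \<bullet> oim h) *\<^sub>R B (zcoord x) +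
       (inverse (norm (oim x)) *\<^sub>R (oim x \<odot> ((h \<bullet> oone) *\<^sub>R B (zcoord x) + (J \<bullet> oim h) *\<^sub>R A (zcoord x))
         + oim h \<odot> Q (zcoord x))
       + (- (inverse (norm (oim x)) * (J \<bullet> oim h) * inverse (norm (oim x)))) *\<^sub>R (oim x \<odot> Q (zcoord x))) =
      (h \<bullet> oone) *\<^sub>R (A (zcoord x) + J \<odot> B (zcoord x)) +
      (J \<bullet> oim h) *\<^sub>R (J \<odot> A (zcoord x) - B (zcoord x)) +
      (oim h - (J \<bullet> oim h) *\<^sub>R J) \<odot> (Q (zcoord x) /\<^sub>R norm (oim x))"
      unfolding n_def[symmetric] unfolding o
      by (simp add: n omult.add_right omult.diff_left omult.scaleR_left
          omult.scaleR_right scaleR_add_right scaleR_diff_right)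
  qed
  finally show ?thesis
  proof (rule has_derivative_transform_within_open)
    show "open {x. zcoord x \<in> D}"
      using continuous_on_zcoord[of UNIV] open_D by (simp add: continuous_on_open_vimage vimage_def)
    show "P (zcoord y) + inverse (norm (oim y)) *\<^sub>R (oim y \<odot> Q (zcoord y)) = f y" if "y \<in> {x. zcoord x \<in> D}" for y
      using that by (simp add: f_eq sgn_div_norm omult.scaleR_left)
  qed (use z in simp)
qed

text \<open>Sphere directions \<open>v\<close> contribute multiples of \<open>v \<odot> Q z\<close>,
  orthogonal to both \<open>Q z\<close> and \<open>J \<odot> Q z\<close>. Projecting onto these two
  vectors leaves a 2 by 2 system for the slice directions with determinant
  \<open>u\<^sup>2 + w\<^sup>2\<close>, a quarter of the squared modulus of
  \<open>Nd\<close>.\<close>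

lemma bij_derivative_nonreal:
  assumes z: "zcoord x \<in> D" and x: "oim x \<noteq> 0" and Q: "Q (zcoord x) \<noteq> 0"
    and Nd: "Nd (f x) (zcoord x) \<noteq> 0"
  shows "bij (frechet_derivative f (at x))"
proof -
  define z where "z = zcoord x"
  define J where "J = sgn (oim x)"
  define L where "L h = (h \<bullet> oone) *\<^sub>R (A z + J \<odot> B z) + (J \<bullet> oim h) *\<^sub>R (J \<odot> A z - B z) +
      (oim h - (J \<bullet> oim h) *\<^sub>R J) \<odot> (Q z /\<^sub>R norm (oim x))" for h
  have J: "J \<in> imag_units" using x by (simp add: J_def sgn_oim_imag_units)
  have L: "(f has_derivative L) (at x)"
    using has_derivative_nonreal[OF assms(1) x] by (simp add: L_def[abs_def] J_def z_def)
  have lin: "linear L" using L by (rule has_derivative_linear)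
  define u where "u = Q z \<bullet> A z + Q z \<bullet> (J \<odot> B z)"
  define w where "w = Q z \<bullet> (J \<odot> A z) - Q z \<bullet> B z"
  have skew: "(J \<odot> Q z) \<bullet> y = - (Q z \<bullet> (J \<odot> y))" for y using imag_units_skew[OF J] .
  have "Nd (f x) z = 2 * Complex w u"
    using f_eq[OF assms(1)] by (simp add: Nd_preimage skew w_def u_def flip: z_def J_def)
  with Nd have uw: "u\<^sup>2 + w\<^sup>2 \<noteq> 0" by (auto simp: z_def complex_eq_iff)
  have "h = 0" if Lh: "L h = 0" for h
  proof -
    define a k v where "a = h \<bullet> oone" and "k = J \<bullet> oim h" and "v = oim h - k *\<^sub>R J"
    have v: "v \<bullet> oone = 0" "v \<bullet> J = 0"
      using J by (simp_all add: v_def k_def inner_diff_left inner_commute[of "oim h" J] imag_units_iff norm_eq_1)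
    have vQ: "(v \<odot> Q z) \<bullet> Q z = 0" "(v \<odot> Q z) \<bullet> (J \<odot> Q z) = 0"
      using inner_omult_right[of v "Q z" oone] inner_omult_right[of v "Q z" J] v by simp_all
    have 0: "a *\<^sub>R (A z + J \<odot> B z) + k *\<^sub>R (J \<odot> A z - B z) + (v \<odot> Q z) /\<^sub>R norm (oim x) = 0"
      using Lh by (simp add: L_def a_def k_def v_def omult.scaleR_right)
    have c1: "A z \<bullet> Q z = Q z \<bullet> A z" "B z \<bullet> Q z = Q z \<bullet> B z"
      "(J \<odot> A z) \<bullet> Q z = Q z \<bullet> (J \<odot> A z)" "(J \<odot> B z) \<bullet> Q z = Q z \<bullet> (J \<odot> B z)"
      by (rule inner_commute)+
    have c2: "y \<bullet> (J \<odot> Q z) = - (Q z \<bullet> (J \<odot> y))" "(J \<odot> y) \<bullet> (J \<odot> Q z) = Q z \<bullet> y" for y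
      using skew[of y] inner_omult_left[of J y "Q z"] J
      by (simp_all add: inner_commute[of y] imag_units_norm)
    have "(a *\<^sub>R (A z + J \<odot> B z) + k *\<^sub>R (J \<odot> A z - B z) + (v \<odot> Q z) /\<^sub>R norm (oim x)) \<bullet> Q z = 0"
      "(a *\<^sub>R (A z + J \<odot> B z) + k *\<^sub>R (J \<odot> A z - B z) + (v \<odot> Q z) /\<^sub>R norm (oim x)) \<bullet> (J \<odot> Q z) = 0"
      unfolding 0 by simp_all
    then have 1: "a * u + k * w = 0" and 2: "k * u - a * w = 0"
      by (simp_all add: inner_add_left inner_diff_left u_def w_def c1 c2(1)[of "A z"] c2(1)[of "B z"] c2(2) vQ
        algebra_simps)
    have "(a\<^sup>2 + k\<^sup>2) * (u\<^sup>2 + w\<^sup>2) = (a * u + k * w)\<^sup>2 + (k * u - a * w)\<^sup>2"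
      by (simp add: power2_eq_square algebra_simps)
    then have "(a\<^sup>2 + k\<^sup>2) * (u\<^sup>2 + w\<^sup>2) = 0" by (simp only: 1 2) simp
    then have "a\<^sup>2 + k\<^sup>2 = 0" using uw mult_eq_0_iff by blast
    then have ak: "a = 0" "k = 0" by (simp_all add: sum_power2_eq_zero_iff)
    then have "v \<odot> Q z = 0" using 0 x by simp
    then have "v = 0" using Q by (simp add: omult_eq_0_iff z_def)
    then show "h = 0" using ak by (simp add: v_def a_def oim_def)
  qed
  then have "inj L" using lin by (simp add: linear_injective_0)
  then have "bij L" using lin linear_injective_imp_surjective bij_def by blast
  then show ?thesis using frechet_derivative_at[OF L] by simp
qed

text \<open>\<open>zcoord\<close> is not differentiable here, so the limit is estimated directly:
  \<open>x\<close> lies in every slice, each increment can be measured in a slice through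
  \<open>y\<close>, and the bounds for \<open>P\<close> and \<open>Q\<close> do not depend on
  \<open>J\<close>.\<close>

lemma has_derivative_real:
  assumes z: "zcoord x \<in> D" and x: "oim x = 0"
  shows "(f has_derivative (\<lambda>h. h \<odot> A (zcoord x))) (at x)"
  unfolding has_derivative_at_alt
proof (intro conjI allI impI)
  show "bounded_linear (\<lambda>h. h \<odot> A (zcoord x))" by (rule omult.bounded_linear_left)
  fix e :: real assume e: "0 < e"
  let ?z = "zcoord x"
  have z0: "Im ?z = 0" using x by (simp add: zcoord_def)
  have B: "B ?z = 0" and Q: "Q ?z = 0" using real_point[OF z z0] by simp_all
  have xz: "x = point ?z J" for J using point_zcoord[of x] z0 by (simp add: point_def)
  have "\<exists>d>0. \<forall>y. norm (y - ?z) < d \<longrightarrow> norm (P y - P ?z - (Re (y - ?z) *\<^sub>R A ?z - Im (y - ?z) *\<^sub>R B ?z)) \<le> e/2 * norm (y - ?z)"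
    using P_deriv[OF z] e half_gt_zero unfolding has_derivative_at_alt by blast
  then obtain d1 where d1: "d1 > 0" "\<And>y. norm (y - ?z) < d1 \<Longrightarrow>
    norm (P y - P ?z - Re (y - ?z) *\<^sub>R A ?z) \<le> e/2 * norm (y - ?z)" by (auto simp: B)
  have "\<exists>d>0. \<forall>y. norm (y - ?z) < d \<longrightarrow> norm (Q y - Q ?z - (Re (y - ?z) *\<^sub>R B ?z + Im (y - ?z) *\<^sub>R A ?z)) \<le> e/2 * norm (y - ?z)"
    using Q_deriv[OF z] e half_gt_zero unfolding has_derivative_at_alt by blast
  then obtain d2 where d2: "d2 > 0" "\<And>y. norm (y - ?z) < d2 \<Longrightarrow>
    norm (Q y - Im (y - ?z) *\<^sub>R A ?z) \<le> e/2 * norm (y - ?z)" by (auto simp: B Q)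
  obtain d3 where d3: "d3 > 0" "ball ?z d3 \<subseteq> D" using open_D z openE by blast
  show "\<exists>d>0. \<forall>y. norm (y - x) < d \<longrightarrow> norm (f y - f x - (y - x) \<odot> A ?z) \<le> e * norm (y - x)"
  proof (intro exI[of _ "min d1 (min d2 d3)"] conjI allI impI)
    show "0 < min d1 (min d2 d3)" using d1 d2 d3 by simp
    fix y assume y: "norm (y - x) < min d1 (min d2 d3)"
    obtain J where J: "J \<in> imag_units" and yz: "y = point (zcoord y) J" by (rule ex_point)
    have n: "norm (zcoord y - ?z) = norm (y - x)"
      using norm_point_diff[OF J, of "zcoord y" ?z] unfolding yz[symmetric] xz[symmetric] by simp
    then have "zcoord y \<in> D" using y d3 by (auto simp: dist_norm norm_minus_commute subset_iff)
    then have fy: "f y = P (zcoord y) + J \<odot> Q (zcoord y)" using f_point[OF _ J] yz by metis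
    have fx: "f x = P ?z" using f_eq[OF z] by (simp add: Q omult.zero_right)
    have dy: "y - x = Re (zcoord y - ?z) *\<^sub>R oone + Im (zcoord y - ?z) *\<^sub>R J"
      by (subst yz, subst xz[of J]) (simp add: point_def algebra_simps)
    have "f y - f x - (y - x) \<odot> A ?z =
       (P (zcoord y) - P ?z - Re (zcoord y - ?z) *\<^sub>R A ?z) + J \<odot> (Q (zcoord y) - Im (zcoord y - ?z) *\<^sub>R A ?z)"
      unfolding fy fx dy by (simp add: omult.add_left omult.scaleR_left omult.scaleR_right
        omult.add_right omult.diff_left omult.diff_right algebra_simps)
    also have "norm \<dots> \<le> norm (P (zcoord y) - P ?z - Re (zcoord y - ?z) *\<^sub>R A ?z) + norm (Q (zcoord y) - Im (zcoord y - ?z) *\<^sub>R A ?z)"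
      using norm_triangle_ineq[of _ "J \<odot> (Q (zcoord y) - Im (zcoord y - ?z) *\<^sub>R A ?z)"] J
      by (simp add: norm_omult imag_units_norm)
    also have "\<dots> \<le> e/2 * norm (y - x) + e/2 * norm (y - x)"
      using d1(2)[of "zcoord y"] d2(2)[of "zcoord y"] y unfolding n by (intro add_mono) auto
    finally show "norm (f y - f x - (y - x) \<odot> A ?z) \<le> e * norm (y - x)" by simp
  qed
qed

lemma bij_derivative_real:
  assumes z: "zcoord x \<in> D" and x: "oim x = 0" and A: "A (zcoord x) \<noteq> 0"
  shows "bij (frechet_derivative f (at x))"
proof -
  have L: "(f has_derivative (\<lambda>h. h \<odot> A (zcoord x))) (at x)" by (rule has_derivative_real[OF z x])
  have lin: "linear (\<lambda>h. h \<odot> A (zcoord x))" using L by (rule has_derivative_linear)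
  have "inj (\<lambda>h. h \<odot> A (zcoord x))" using A linear_injective_0[OF lin] by (simp add: omult_eq_0_iff)
  then have "bij (\<lambda>h. h \<odot> A (zcoord x))" using lin linear_injective_imp_surjective bij_def by blast
  then show ?thesis using frechet_derivative_at[OF L] by simp
qed

end

subsection \<open>Non-injectivity at singular points\<close>

lemma minimum_modulus_cball:
  assumes h: "h holomorphic_on S" and S: "cball a r \<subseteq> S" and nz: "\<And>z. z \<in> cball a r \<Longrightarrow> h z \<noteq> 0"
    and c: "c > 0" "\<And>z. z \<in> sphere a r \<Longrightarrow> c \<le> norm (h z)" and w: "w \<in> cball a r"
  shows "c \<le> norm (h w)"
proof -
  have hol: "(\<lambda>z. inverse (h z)) holomorphic_on cball a r"
    using holomorphic_on_subset[OF h S] nz by (intro holomorphic_intros) auto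
  have "norm (inverse (h w)) \<le> inverse c"
  proof (rule maximum_modulus_frontier[of "\<lambda>z. inverse (h z)" "cball a r" "inverse c" w])
    show "(\<lambda>z. inverse (h z)) holomorphic_on interior (cball a r)"
      using hol by (rule holomorphic_on_subset) (rule interior_subset)
    show "continuous_on (closure (cball a r)) (\<lambda>z. inverse (h z))"
      using holomorphic_on_imp_continuous_on[OF hol] by simp
    show "norm (inverse (h z)) \<le> inverse c" if "z \<in> frontier (cball a r)" for z
      using c that by (auto simp: norm_inverse intro!: le_imp_inverse_le)
  qed (use w in auto)
  then show ?thesis using c(1) nz[OF w] by (simp add: norm_inverse)
qed

lemma holomorphic_factor_zero:
  assumes "g holomorphic_on S" "open S" "g a = 0"
  obtains h where "h holomorphic_on S" "\<And>z. g z = (z - a) * h z" "h a = deriv g a"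
proof (rule that)
  show "(\<lambda>z. if z = a then deriv g a else (g z - g a) / (z - a)) holomorphic_on S"
    using assms(1,2) by (rule pole_lemma_open)
qed (use assms(3) in auto)

text \<open>The quotient of \<open>g z\<close> by \<open>z - w\<close> is zero-free on the disc and
  equals the derivative at \<open>w\<close>. On the circle it is at least
  \<open>c / (2 * r)\<close>, as two points of the closed disc are at most \<open>2 * r\<close>
  apart.\<close>

lemma norm_deriv_unique_zero_ge:
  assumes g: "g holomorphic_on S" "open S" and S: "cball a r \<subseteq> S" and w: "w \<in> ball a r"
    and "g w = 0" "deriv g w \<noteq> 0" and uniq: "\<And>z. z \<in> cball a r \<Longrightarrow> g z = 0 \<Longrightarrow> z = w"
    and c: "c > 0" "\<And>z. z \<in> sphere a r \<Longrightarrow> c \<le> norm (g z)"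
  shows "c \<le> 2 * r * norm (deriv g w)"
proof -
  have r: "r > 0" using w le_less_trans[OF zero_le_dist] by auto
  obtain h where h: "h holomorphic_on S" "\<And>z. g z = (z - w) * h z" "h w = deriv g w"
    using holomorphic_factor_zero[OF g] assms by metis
  have "c / (2 * r) \<le> norm (h w)"
  proof (rule minimum_modulus_cball[OF h(1) S])
    show "h z \<noteq> 0" if "z \<in> cball a r" for z
      using uniq[OF that] h(2)[of z] h(3) assms by auto
    show "c / (2 * r) \<le> norm (h z)" if z: "z \<in> sphere a r" for z
    proof -
      have "norm (z - w) \<le> 2 * r"
        using z w dist_triangle2[of z w a] by (simp add: dist_norm norm_minus_commute)
      then have "c \<le> (2 * r) * norm (h z)"
        using c(2)[OF z] h(2)[of z] mult_right_mono[of "norm (z - w)" "2 * r" "norm (h z)"]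
        by (simp add: norm_mult)
      then show ?thesis using r by (simp add: field_simps)
    qed
  qed (use c r w in auto)
  then show ?thesis using r h(3) by (simp add: field_simps)
qed

text \<open>After division by both linear factors the value at \<open>w\<close> is
  \<open>deriv g w / (w - w')\<close>, so the bound degrades in proportion to the distance of the
  two zeros.\<close>

lemma norm_deriv_two_zeros_ge:
  assumes g: "g holomorphic_on S" "open S" and S: "cball a r \<subseteq> S"
    and w: "w \<in> ball a r" "w' \<in> ball a r" "w \<noteq> w'"
    and 0: "g w = 0" "g w' = 0" and d: "deriv g w \<noteq> 0" "deriv g w' \<noteq> 0"
    and uniq: "\<And>z. z \<in> cball a r \<Longrightarrow> g z = 0 \<Longrightarrow> z = w \<or> z = w'"
    and c: "c > 0" "\<And>z. z \<in> sphere a r \<Longrightarrow> c \<le> norm (g z)"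
  shows "c * norm (w - w') \<le> (2 * r)\<^sup>2 * norm (deriv g w)"
proof -
  have r: "r > 0" using w le_less_trans[OF zero_le_dist] by auto
  obtain h where h: "h holomorphic_on S" "\<And>z. g z = (z - w) * h z" "h w = deriv g w"
    using holomorphic_factor_zero[OF g 0(1)] by metis
  have "h w' = 0" using h(2)[of w'] 0 w by simp
  then obtain k where k: "k holomorphic_on S" "\<And>z. h z = (z - w') * k z"
    using holomorphic_factor_zero[OF h(1) g(2)] by metis
  have gk: "g = (\<lambda>z. (z - w) * ((z - w') * k z))" using h(2) k(2) by auto
  have "w' \<in> S" using w S by auto
  then have "(k has_field_derivative deriv k w') (at w')"
    using holomorphic_derivI[OF k(1) g(2)] by blast
  then have "(g has_field_derivative (w' - w) * k w') (at w')"
    unfolding gk by (auto intro!: derivative_eq_intros)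
  then have kw': "k w' \<noteq> 0" using d(2) by (auto dest: DERIV_imp_deriv)
  have "c / (2 * r)\<^sup>2 \<le> norm (k w)"
  proof (rule minimum_modulus_cball[OF k(1) S])
    show "k z \<noteq> 0" if "z \<in> cball a r" for z
      using uniq[OF that] h(3) k(2)[of w] kw' d(1) w(3) by (auto simp: gk)
    show "c / (2 * r)\<^sup>2 \<le> norm (k z)" if z: "z \<in> sphere a r" for z
    proof -
      have "norm (z - w) \<le> 2 * r" "norm (z - w') \<le> 2 * r"
        using z w dist_triangle2[of z w a] dist_triangle2[of z w' a]
        by (simp_all add: dist_norm norm_minus_commute)
      then have "norm (z - w) * norm (z - w') \<le> (2 * r)\<^sup>2"
        unfolding power2_eq_square using r by (intro mult_mono) auto
      then have "c \<le> (2 * r)\<^sup>2 * norm (k z)"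
        using c(2)[OF z] mult_right_mono[of "norm (z - w) * norm (z - w')" "(2 * r)\<^sup>2" "norm (k z)"]
        by (simp add: gk norm_mult mult.assoc)
      then show ?thesis using r by (simp add: field_simps)
    qed
  qed (use c r w in auto)
  then have "c \<le> (2 * r)\<^sup>2 * norm (k w)" using r by (simp add: field_simps)
  then have "c * norm (w - w') \<le> (2 * r)\<^sup>2 * norm (k w) * norm (w - w')" by (rule mult_right_mono) simp
  moreover have "norm (deriv g w) = norm (w - w') * norm (k w)" using h(3) k(2)[of w] by (metis norm_mult)
  ultimately show ?thesis by (simp add: mult_ac)
qed

section \<open>Behaviour of the normal function under small changes of the value\<close>

context stem
begin

text \<open>Uniform continuity in both variables lets the minimum over \<open>K\<close> for
  \<open>q0\<close>, halved, serve for all nearby \<open>q\<close>; this makes the later lower bound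
  independent of the nearby value. The radius 1 only supplies a compact set of values.\<close>

lemma N_bounded_below_near:
  assumes K: "compact K" "K \<subseteq> D" and nz: "\<And>z. z \<in> K \<Longrightarrow> N q0 z \<noteq> 0"
  obtains c d where "c > 0" "d > 0" "\<And>q z. norm (q - q0) < d \<Longrightarrow> z \<in> K \<Longrightarrow> c \<le> norm (N q z)"
proof (cases "K = {}")
  case False
  have "continuous_on K (\<lambda>z. norm (N q0 z))"
    using holomorphic_on_imp_continuous_on[OF N_holomorphic[OF K(2)]] by (intro continuous_intros)
  then obtain z0 where z0: "z0 \<in> K" "\<And>z. z \<in> K \<Longrightarrow> norm (N q0 z0) \<le> norm (N q0 z)"
    using continuous_attains_inf[OF K(1) False] by blast
  define c where "c = norm (N q0 z0)"
  have c: "c > 0" using nz z0 by (simp add: c_def)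
  have P: "continuous_on (cball q0 1 \<times> K) (\<lambda>x. P (snd x))" and Q: "continuous_on (cball q0 1 \<times> K) (\<lambda>x. Q (snd x))"
    by (rule continuous_on_compose2[OF cont_P] continuous_on_compose2[OF cont_Q];
        use K in \<open>auto intro!: continuous_intros\<close>)+
  have "continuous_on (cball q0 1 \<times> K) (\<lambda>x. N (fst x) (snd x))"
    unfolding N_def Complex_eq by (intro continuous_intros P Q)
  moreover have "compact (cball q0 1 \<times> K)" using K by (intro compact_Times) auto
  ultimately have "uniformly_continuous_on (cball q0 1 \<times> K) (\<lambda>x. N (fst x) (snd x))"
    by (rule compact_uniformly_continuous)
  then obtain d where d: "d > 0" "\<And>x y. x \<in> cball q0 1 \<times> K \<Longrightarrow> y \<in> cball q0 1 \<times> K \<Longrightarrow> dist y x < d \<Longrightarrow>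
      dist (N (fst y) (snd y)) (N (fst x) (snd x)) < c / 2"
    unfolding uniformly_continuous_on_def using c half_gt_zero by metis
  show ?thesis
  proof (rule that[of "c / 2" "min d 1"])
    fix q z assume q: "norm (q - q0) < min d 1" and z: "z \<in> K"
    then have "dist (N q z) (N q0 z) < c / 2"
      using d(2)[of "(q0, z)" "(q, z)"] by (simp add: dist_Pair_Pair dist_norm norm_minus_commute)
    moreover have "c \<le> norm (N q0 z)" using z0 z by (simp add: c_def)
    moreover have "norm (N q0 z) \<le> norm (N q z) + dist (N q z) (N q0 z)"
      using norm_triangle_ineq2[of "N q0 z" "N q z"] by (simp add: dist_norm norm_minus_commute)
    ultimately show "c / 2 \<le> norm (N q z)" by linarith
  qed (use c d in auto)
qed (rule that[of 1 1], auto)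

lemma P_Q_constant:
  assumes S: "convex S" "S \<subseteq> D" and "\<And>z. z \<in> S \<Longrightarrow> A z = 0" "\<And>z. z \<in> S \<Longrightarrow> B z = 0"
    and zw: "z \<in> S" "w \<in> S"
  shows "P z = P w" "Q z = Q w"
proof -
  have "(P has_derivative (\<lambda>h. 0)) (at z within S)" "(Q has_derivative (\<lambda>h. 0)) (at z within S)" if "z \<in> S" for z
    using has_derivative_at_withinI[OF P_deriv[of z]] has_derivative_at_withinI[OF Q_deriv[of z]] that assms(3,4) S(2)
    by (simp_all add: subset_iff)
  then have "\<exists>c. \<forall>z\<in>S. P z = c" "\<exists>c. \<forall>z\<in>S. Q z = c"
    using has_derivative_zero_constant[OF S(1), of P] has_derivative_zero_constant[OF S(1), of Q] by blast+
  then show "P z = P w" "Q z = Q w" using zw by auto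
qed

lemma deriv_N: "z \<in> D \<Longrightarrow> deriv (N q) z = Nd q z"
  using N_deriv by (rule DERIV_imp_deriv)

text \<open>Comes from writing \<open>(J - K) \<odot> Q w\<close> as the difference of the two
  values minus \<open>P z - P w\<close> and \<open>J \<odot> (Q z - Q w)\<close>. Where
  \<open>Q w\<close> is nonzero, close values over close \<open>z\<close> thus force close imaginary
  units.\<close>

lemma norm_imag_unit_diff_le:
  assumes "J \<in> imag_units"
  shows "norm (J - K) * norm (Q w) \<le>
    norm (P z + J \<odot> Q z - (P w + K \<odot> Q w)) + norm (P z - P w) + norm (Q z - Q w)"
proof -
  have "norm (J - K) * norm (Q w) = norm ((P z + J \<odot> Q z - (P w + K \<odot> Q w)) - (P z - P w) - J \<odot> (Q z - Q w))"
    by (simp add: omult.diff_left omult.diff_right flip: norm_omult)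
  also have "\<dots> \<le> norm (P z + J \<odot> Q z - (P w + K \<odot> Q w)) + norm (P z - P w) + norm (J \<odot> (Q z - Q w))"
    by (intro order_trans[OF norm_triangle_ineq4] add_right_mono norm_triangle_ineq4)
  finally show ?thesis using assms by (simp add: norm_omult imag_units_norm)
qed

end

lemma norm_point_diff_le:
  assumes "J \<in> imag_units"
  shows "norm (point z J - point w K) \<le> norm (z - w) + \<bar>Im w\<bar> * norm (J - K)"
proof -
  have "point z J - point w K = (point z J - point w J) + Im w *\<^sub>R (J - K)"
    by (simp add: point_def algebra_simps)
  then have "norm (point z J - point w K) \<le> norm (point z J - point w J) + norm (Im w *\<^sub>R (J - K))"
    by (metis norm_triangle_ineq)
  then show ?thesis by (simp add: norm_point_diff[OF assms])
qed

section \<open>Injectivity near a singular point is contradictory\<close>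

context slice_function
begin

text \<open>The disc is taken in the open upper half plane, so that a point determines its
  \<open>z\<close> and distinct zeros of \<open>N q\<close> give distinct preimages.\<close>

lemma not_inj_on_ball_nonreal:
  assumes \<epsilon>: "\<epsilon> > 0" "ball x0 \<epsilon> \<subseteq> zcoord -` D" and x0: "oim x0 \<noteq> 0"
    and sing: "\<not> bij (frechet_derivative f (at x0))"
  shows "\<not> inj_on f (ball x0 \<epsilon>)"
proof
  assume inj: "inj_on f (ball x0 \<epsilon>)"
  define z0 J0 q0 where "z0 = zcoord x0" and "J0 = sgn (oim x0)" and "q0 = f x0"
  have J0: "J0 \<in> imag_units" using x0 by (simp add: J0_def sgn_oim_imag_units)
  have x0_point: "x0 = point z0 J0" unfolding z0_def J0_def by (rule point_zcoord)
  have "x0 \<in> ball x0 \<epsilon>" using \<epsilon>(1) by simp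
  then have z0: "z0 \<in> D" using \<epsilon>(2) unfolding z0_def by blast
  have Im0: "Im z0 > 0" using x0 by (simp add: z0_def zcoord_def)
  have q0: "q0 = P z0 + J0 \<odot> Q z0" using f_point[OF z0 J0] by (simp add: q0_def x0_point)
  have Q0: "Q z0 \<noteq> 0"
  proof
    assume Q0: "Q z0 = 0"
    obtain K where K: "K \<in> imag_units" "K \<noteq> J0" "norm (K - J0) < \<epsilon> / Im z0"
      using imag_units_near[OF J0, of "\<epsilon> / Im z0"] \<epsilon>(1) Im0 by auto
    have "norm (point z0 K - x0) < \<epsilon>"
      using norm_point_diff_le[OF K(1), of z0 z0 J0] K(3) Im0 by (simp add: x0_point field_simps)
    moreover have "f (point z0 K) = f x0"
      using f_point[OF z0 K(1)] q0 by (simp add: q0_def Q0 omult.zero_right)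
    ultimately have "point z0 K = point z0 J0"
      using inj \<epsilon>(1) unfolding x0_point by (auto simp: inj_on_def dist_norm norm_minus_commute)
    then show False using K(2) Im0 by (simp add: point_def)
  qed
  then have Nd0: "Nd q0 z0 = 0"
    using bij_derivative_nonreal[of x0] x0 z0 sing by (auto simp: z0_def q0_def)
  \<comment> \<open>Calibrated for \<open>norm_imag_unit_diff_le\<close>: each of its three terms
    gets a third, and a total below \<open>\<sigma>\<close> means that
    \<open>Im z0 * norm (J - J0)\<close> is below half of \<open>\<epsilon>\<close>, the other half
    being left for \<open>z - z0\<close>.\<close>
  define \<sigma> where "\<sigma> = \<epsilon> * norm (Q z0) / (2 * Im z0)"
  have \<sigma>: "\<sigma> > 0" using \<epsilon> Q0 Im0 by (simp add: \<sigma>_def)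
  have ev: "\<forall>\<^sub>F z in nhds z0. norm (P z - P z0) < \<sigma> / 3 \<and> norm (Q z - Q z0) < \<sigma> / 3 \<and>
      norm (z - z0) < \<epsilon> / 2 \<and> z \<in> D \<and> Im z > 0"
  proof (intro eventually_conj)
    have "isCont P z0" "isCont Q z0"
      using cont_P cont_Q open_D z0 by (simp_all add: continuous_on_eq_continuous_at)
    then have t: "(P \<longlongrightarrow> P z0) (nhds z0)" "(Q \<longlongrightarrow> Q z0) (nhds z0)" by (simp_all add: isCont_def tendsto_nhds_iff)
    show "\<forall>\<^sub>F z in nhds z0. norm (P z - P z0) < \<sigma> / 3" "\<forall>\<^sub>F z in nhds z0. norm (Q z - Q z0) < \<sigma> / 3"
      using tendstoD[OF t(1), of "\<sigma> / 3"] tendstoD[OF t(2), of "\<sigma> / 3"] \<sigma> by (simp_all add: dist_norm)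
    show "\<forall>\<^sub>F z in nhds z0. norm (z - z0) < \<epsilon> / 2"
      using \<epsilon> by (auto simp: eventually_nhds_metric dist_norm intro!: exI[of _ "\<epsilon> / 2"])
    show "\<forall>\<^sub>F z in nhds z0. z \<in> D" using open_D z0 by (rule eventually_nhds_in_open)
    show "\<forall>\<^sub>F z in nhds z0. Im z > 0"
      using eventually_nhds_in_open[OF open_halfspace_Im_gt[of 0], of z0] Im0 by simp
  qed
  then obtain r' where r': "r' > 0" "\<And>z. dist z z0 < r' \<Longrightarrow> norm (P z - P z0) < \<sigma> / 3 \<and> norm (Q z - Q z0) < \<sigma> / 3 \<and>
      norm (z - z0) < \<epsilon> / 2 \<and> z \<in> D \<and> Im z > 0"
    unfolding eventually_nhds_metric by auto
  define r where "r = r' / 2"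
  have r: "r > 0" using r' by (simp add: r_def)
  have cb: "norm (P z - P z0) < \<sigma> / 3" "norm (Q z - Q z0) < \<sigma> / 3" "norm (z - z0) < \<epsilon> / 2" "z \<in> D" "Im z > 0"
    if "z \<in> cball z0 r" for z
    using r'(2)[of z] r'(1) that by (auto simp: r_def dist_commute)
  \<comment> \<open>Preimages over the disc of a value close to \<open>q0\<close> lie in the ball
    automatically, so injectivity on the ball controls every zero of \<open>N q\<close> in the
    disc.\<close>
  have near: "point z J \<in> ball x0 \<epsilon>"
    if z: "z \<in> cball z0 r" and J: "J \<in> imag_units" and q: "norm (P z + J \<odot> Q z - q0) < \<sigma> / 3" for z J
  proof -
    have "norm (J - J0) * norm (Q z0) < \<sigma>"
      using norm_imag_unit_diff_le[OF J, of J0 z0 z] cb[OF z] q unfolding q0 by linarith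
    then have "Im z0 * norm (J - J0) < \<epsilon> / 2" using Q0 Im0 by (simp add: \<sigma>_def field_simps)
    then have "norm (point z J - x0) < \<epsilon>"
      using norm_point_diff_le[OF J, of z z0 J0] cb(3)[OF z] Im0 by (simp add: x0_point)
    then show ?thesis by (simp add: dist_norm norm_minus_commute)
  qed
  have eqI: "z = w"
    if "z \<in> cball z0 r" "w \<in> cball z0 r" "J \<in> imag_units" "K \<in> imag_units"
      "P z + J \<odot> Q z = q" "P w + K \<odot> Q w = q" "norm (q - q0) < \<sigma> / 3" for z w J K q
  proof -
    have "point z J = point w K"
    proof (rule inj_onD[OF inj _ near near])
      show "f (point z J) = f (point w K)" using that cb(4) by (simp add: f_point)
    qed (use that in auto)
    then have "Complex (Re z) \<bar>Im z\<bar> = Complex (Re w) \<bar>Im w\<bar>" using that zcoord_point by metis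
    then show "z = w" using cb(5)[of z] cb(5)[of w] that by (simp add: complex_eq_iff)
  qed
  have z0r: "z0 \<in> cball z0 r" using r by simp
  have "N q0 z \<noteq> 0" if "z \<in> sphere z0 r" for z
  proof
    assume "N q0 z = 0"
    then obtain J where J: "J \<in> imag_units" "P z + J \<odot> Q z = q0" using N_eq_0_imp_preimage by blast
    have "z \<in> cball z0 r" using that by simp
    then have "z = z0" by (rule eqI[OF _ z0r J(1) J0 J(2) q0[symmetric]]) (use \<sigma> in simp)
    then show False using that r by simp
  qed
  then obtain c d where cd: "c > 0" "d > 0" "\<And>q z. norm (q - q0) < d \<Longrightarrow> z \<in> sphere z0 r \<Longrightarrow> c \<le> norm (N q z)"
    using N_bounded_below_near[of "sphere z0 r" q0] cb(4) by (auto simp: subset_iff)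
  define FF where "FF = (\<lambda>x. P (fst x) + snd x \<odot> Q (fst x))"
  \<comment> \<open>The threshold \<open>c / (2 * r)\<close> for \<open>Nd\<close> is the lower
    bound that \<open>norm_deriv_unique_zero_ge\<close> gives at a simple zero. As the estimate
    holds on a whole neighbourhood of (z0, J0), it remains to find there a pair with nonzero
    \<open>Nd\<close>.\<close>
  have "\<forall>\<^sub>F x in nhds (z0, J0). norm (FF x - q0) < min d (\<sigma> / 3) \<and> norm (Nd (FF x) (fst x)) < c / (2 * r) \<and> dist (fst x) z0 < r"
  proof (intro eventually_conj)
    have oD: "open (D \<times> (UNIV :: octonion set))" using open_D by (intro open_Times) auto
    have *: "continuous_on (D \<times> UNIV) (\<lambda>x. P (fst x))" "continuous_on (D \<times> UNIV) (\<lambda>x. Q (fst x))"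
      "continuous_on (D \<times> UNIV) (\<lambda>x. A (fst x))" "continuous_on (D \<times> UNIV) (\<lambda>x. B (fst x))"
      by (rule continuous_on_compose2[OF cont_P] continuous_on_compose2[OF cont_Q]
          continuous_on_compose2[OF cont_A] continuous_on_compose2[OF cont_B];
          auto intro!: continuous_intros)+
    have 1: "continuous_on (D \<times> UNIV) FF"
      unfolding FF_def by (intro continuous_intros omult.continuous_on *)
    have z0J0: "(z0, J0) \<in> interior (D \<times> UNIV)" using z0 by (simp only: interior_open[OF oD]) simp
    then have "isCont FF (z0, J0)" using continuous_on_interior[OF 1] by blast
    then have "(FF \<longlongrightarrow> q0) (nhds (z0, J0))"
      by (simp add: isCont_def tendsto_nhds_iff FF_def q0)
    then show "\<forall>\<^sub>F x in nhds (z0, J0). norm (FF x - q0) < min d (\<sigma> / 3)"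
      using tendstoD[of FF q0 _ "min d (\<sigma> / 3)"] \<sigma> cd by (simp add: dist_norm)
    have 2: "continuous_on (D \<times> UNIV) (\<lambda>x. norm (Nd (FF x) (fst x)))"
      unfolding Nd_def Complex_eq by (intro continuous_intros 1 *)
    have "isCont (\<lambda>x. norm (Nd (FF x) (fst x))) (z0, J0)" by (rule continuous_on_interior[OF 2 z0J0])
    then have "((\<lambda>x. norm (Nd (FF x) (fst x))) \<longlongrightarrow> 0) (nhds (z0, J0))"
      using Nd0 by (simp add: isCont_def tendsto_nhds_iff FF_def flip: q0)
    then show "\<forall>\<^sub>F x in nhds (z0, J0). norm (Nd (FF x) (fst x)) < c / (2 * r)"
      using cd r by (intro order_tendstoD(2)) auto
    have "isCont (\<lambda>x :: complex \<times> octonion. dist (fst x) z0) (z0, J0)" by (intro continuous_intros)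
    then have "((\<lambda>x. dist (fst x) z0) \<longlongrightarrow> 0) (nhds (z0, J0))" by (simp add: isCont_def tendsto_nhds_iff)
    then show "\<forall>\<^sub>F x in nhds (z0, J0). dist (fst x) z0 < r"
      using r by (intro order_tendstoD(2)) auto
  qed
  then obtain S T where ST: "open S" "z0 \<in> S" "open T" "J0 \<in> T"
    and *: "\<And>z J. z \<in> S \<Longrightarrow> J \<in> T \<Longrightarrow> norm (P z + J \<odot> Q z - q0) < min d (\<sigma> / 3) \<and>
      norm (Nd (P z + J \<odot> Q z) z) < c / (2 * r) \<and> dist z z0 < r"
  proof -
    assume a: "\<forall>\<^sub>F x in nhds (z0, J0). norm (FF x - q0) < min d (\<sigma> / 3) \<and> norm (Nd (FF x) (fst x)) < c / (2 * r) \<and> dist (fst x) z0 < r"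
    then obtain W where W0: "open W" "(z0, J0) \<in> W" and W: "\<And>x. x \<in> W \<Longrightarrow> norm (FF x - q0) < min d (\<sigma> / 3) \<and>
       norm (Nd (FF x) (fst x)) < c / (2 * r) \<and> dist (fst x) z0 < r"
      unfolding eventually_nhds by blast
    obtain S T where ST: "open S" "open T" "(z0, J0) \<in> S \<times> T" "S \<times> T \<subseteq> W"
      by (rule open_prod_elim[OF W0])
    show ?thesis
    proof (rule that[of S T])
      fix z J assume "z \<in> S" "J \<in> T"
      then have "(z, J) \<in> W" using ST(4) by blast
      from W[OF this] show "norm (P z + J \<odot> Q z - q0) < min d (\<sigma> / 3) \<and>
        norm (Nd (P z + J \<odot> Q z) z) < c / (2 * r) \<and> dist z z0 < r"
        unfolding FF_def fst_conv snd_conv .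
    qed (use ST in auto)
  qed
  obtain e1 where e1: "e1 > 0" "ball z0 e1 \<subseteq> S" using ST openE by blast
  obtain e2 where e2: "e2 > 0" "ball J0 e2 \<subseteq> T" using ST openE by blast
  have "\<exists>z1\<in>ball z0 e1. \<exists>J1\<in>imag_units. J1 \<in> ball J0 e2 \<and> Nd (P z1 + J1 \<odot> Q z1) z1 \<noteq> 0"
  proof (rule ccontr)
    assume no: "\<not> ?thesis"
    have AB: "A z = 0" "B z = 0" if z: "z \<in> ball z0 e1" for z
    proof -
      have z': "z \<in> cball z0 r" using *[of z J0] z e1(2) ST(4) by (auto simp: dist_commute)
      have Qz: "Q z \<noteq> 0"
      proof
        assume "Q z = 0"
        obtain K where K: "K \<in> imag_units" "K \<noteq> J0" using imag_units_near[OF J0, of 1] by auto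
        have "norm (P z - q0) < \<sigma> / 3" using *[of z J0] z e1(2) ST(4) \<open>Q z = 0\<close> by (auto simp: omult.zero_right)
        then have "point z K \<in> ball x0 \<epsilon>" "point z J0 \<in> ball x0 \<epsilon>"
          using near[OF z' K(1)] near[OF z' J0] \<open>Q z = 0\<close> by (simp_all add: omult.zero_right)
        moreover have "f (point z K) = f (point z J0)"
          using f_point cb(4)[OF z'] K J0 \<open>Q z = 0\<close> by (simp add: omult.zero_right)
        ultimately have "point z K = point z J0" using inj_onD[OF inj] by blast
        then show False using K(2) cb(5)[OF z'] by (simp add: point_def)
      qed
      have "Nd (P z + K \<odot> Q z) z = 0" if "K \<in> imag_units" "norm (K - J0) < e2" for K
        using no z that by (auto simp: dist_norm norm_minus_commute)
      then show "A z = 0" "B z = 0" using A_B_eq_0_if_Nd_eq_0_near[OF J0 e2(1) Qz] by auto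
    qed
    \<comment> \<open>With \<open>A\<close> and \<open>B\<close> zero on the disc, \<open>P\<close>
      and \<open>Q\<close> are constant there, so a second point over it with the same unit repeats
      the value \<open>q0\<close>.\<close>
    define w where "w = z0 + of_real (e1 / 2)"
    have w: "w \<in> ball z0 e1" "w \<noteq> z0" using e1 by (auto simp: w_def dist_norm)
    have ball_D: "ball z0 e1 \<subseteq> cball z0 r"
    proof
      fix z assume "z \<in> ball z0 e1"
      then have "z \<in> S" using e1(2) by blast
      from *[OF this ST(4)] show "z \<in> cball z0 r" by (simp add: dist_commute)
    qed
    then have "ball z0 e1 \<subseteq> D" using cb(4) by blast
    then have "P w = P z0" "Q w = Q z0"
      using P_Q_constant[OF convex_ball _ AB, of z0 e1 w z0] w e1(1) by auto
    moreover have "w \<in> cball z0 r" using w ball_D by blast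
    ultimately have "w = z0" using eqI[OF _ z0r J0 J0 _ q0[symmetric], of w] \<sigma> q0 by simp
    then show False using w by simp
  qed
  then obtain z1 J1 where z1: "z1 \<in> ball z0 e1" and J1: "J1 \<in> imag_units" "J1 \<in> ball J0 e2"
    and Nd1: "Nd (P z1 + J1 \<odot> Q z1) z1 \<noteq> 0" by blast
  define q1 where "q1 = P z1 + J1 \<odot> Q z1"
  have q1: "norm (q1 - q0) < d" "norm (q1 - q0) < \<sigma> / 3" "norm (Nd q1 z1) < c / (2 * r)" "dist z1 z0 < r"
    using *[OF subsetD[OF e1(2) z1] subsetD[OF e2(2) J1(2)]] by (simp_all add: q1_def)
  have "c \<le> 2 * r * norm (deriv (N q1) z1)"
  proof (rule norm_deriv_unique_zero_ge[OF N_holomorphic[OF order_refl] open_D])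
    show "cball z0 r \<subseteq> D" using cb(4) by blast
    show z1r: "z1 \<in> ball z0 r" using q1(4) by (simp add: dist_commute)
    show "N q1 z1 = 0" unfolding q1_def by (rule N_preimage[OF J1(1)])
    show "deriv (N q1) z1 \<noteq> 0" using Nd1 deriv_N z1r cb(4)[of z1] by (simp add: q1_def)
    fix z assume z: "z \<in> cball z0 r" and "N q1 z = 0"
    then obtain J where J: "J \<in> imag_units" "P z + J \<odot> Q z = q1" using N_eq_0_imp_preimage by blast
    have "z1 \<in> cball z0 r" using z1r by simp
    from eqI[OF z this J(1) J1(1) J(2) q1_def[symmetric] q1(2)] show "z = z1" .
  qed (use cd q1 in auto)
  moreover have "z1 \<in> D" using cb(4)[of z1] q1(4) by (auto simp: dist_commute)
  ultimately show False using q1(3) r by (simp add: deriv_N field_simps)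
qed

text \<open>The zeros of \<open>N q\<close> come in conjugate pairs, so the lower bound from
  \<open>norm_deriv_two_zeros_ge\<close> carries the factor \<open>2 * Im z1\<close>. The upper
  bound \<open>norm_Nd_preimage_le\<close> carries \<open>norm (Q z1)\<close>, at most
  \<open>Im z1\<close>, times a quantity that tends to 0 because \<open>A\<close> and
  \<open>B\<close> vanish at \<open>z0\<close>.\<close>

lemma not_inj_on_ball_real:
  assumes \<epsilon>: "\<epsilon> > 0" "ball x0 \<epsilon> \<subseteq> zcoord -` D" and x0: "oim x0 = 0"
    and sing: "\<not> bij (frechet_derivative f (at x0))"
  shows "\<not> inj_on f (ball x0 \<epsilon>)"
proof
  assume inj: "inj_on f (ball x0 \<epsilon>)"
  define z0 q0 where "z0 = zcoord x0" and "q0 = f x0"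
  have "x0 \<in> ball x0 \<epsilon>" using \<epsilon>(1) by simp
  then have z0: "z0 \<in> D" using \<epsilon>(2) unfolding z0_def by blast
  have Im0: "Im z0 = 0" using x0 by (simp add: z0_def zcoord_def)
  have x0_point: "x0 = point z0 J" for J
    using point_zcoord[of x0] Im0 by (simp add: z0_def point_def)
  have Q0: "Q z0 = 0" and B0: "B z0 = 0" using real_point[OF z0 Im0] by auto
  have A0: "A z0 = 0" using bij_derivative_real[of x0] x0 z0 sing by (auto simp: z0_def)
  have q0: "q0 = P z0" using f_eq[of x0] z0 by (simp add: q0_def z0_def[symmetric] Q0 omult.zero_right)
  obtain r' where r': "r' > 0" "ball z0 r' \<subseteq> D" using open_D z0 openE by blast
  define r where "r = min r' \<epsilon> / 2"
  have r: "r > 0" "r < \<epsilon>" using r' \<epsilon> by (auto simp: r_def)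
  have cb: "cball z0 r \<subseteq> D" using r' \<epsilon> by (auto simp: r_def subset_iff)
  \<comment> \<open>The real centre lies in every slice, so all points over the disc are within
    distance \<open>r\<close> of \<open>x0\<close>, whatever their unit.\<close>
  have near: "point z J \<in> ball x0 \<epsilon>" if "z \<in> cball z0 r" "J \<in> imag_units" for z J
    using that norm_point_diff[OF that(2), of z0 z] r
    by (simp add: x0_point[of J] dist_norm)
  have eqI: "point z J = point w K"
    if "z \<in> cball z0 r" "w \<in> cball z0 r" "J \<in> imag_units" "K \<in> imag_units"
      "P z + J \<odot> Q z = P w + K \<odot> Q w" for z w J K
  proof (rule inj_onD[OF inj _ near[OF that(1,3)] near[OF that(2,4)]])
    have "z \<in> D" "w \<in> D" using that cb by auto
    then show "f (point z J) = f (point w K)" using that by (simp add: f_point)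
  qed
  have zeqI: "z = w \<or> z = cnj w"
    if "z \<in> cball z0 r" "w \<in> cball z0 r" "J \<in> imag_units" "K \<in> imag_units"
      "P z + J \<odot> Q z = P w + K \<odot> Q w" for z w J K
  proof -
    have "Complex (Re z) \<bar>Im z\<bar> = Complex (Re w) \<bar>Im w\<bar>"
      using eqI[OF that] zcoord_point that(3,4) by metis
    then show ?thesis by (auto simp: complex_eq_iff abs_eq_iff)
  qed
  obtain J0 where J0: "J0 \<in> imag_units" using ex_imag_unit_orthogonal by blast
  have Qnz: "Q z \<noteq> 0" if z: "z \<in> cball z0 r" "Im z \<noteq> 0" for z
  proof
    assume "Q z = 0"
    then have "point z J0 = point z (- J0)"
      by (intro eqI z J0 imag_units_uminus) (simp add: omult.zero_right)
    then have "Im z *\<^sub>R J0 = - (Im z *\<^sub>R J0)" by (simp add: point_def)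
    then have "Im z *\<^sub>R J0 + Im z *\<^sub>R J0 = 0" by (simp only: eq_neg_iff_add_eq_0)
    then have "(Im z + Im z) *\<^sub>R J0 = 0" by (simp only: scaleR_left_distrib)
    then have "J0 = 0" using z(2) by simp
    then show False using J0 by (simp add: imag_units_iff)
  qed
  have z0r: "z0 \<in> cball z0 r" using r by simp
  have cnj0: "cnj z0 = z0" using Im0 by (simp add: complex_eq_iff)
  have "N q0 z \<noteq> 0" if z: "z \<in> sphere z0 r" for z
  proof
    assume "N q0 z = 0"
    then obtain J where J: "J \<in> imag_units" "P z + J \<odot> Q z = q0" using N_eq_0_imp_preimage by blast
    have "z \<in> cball z0 r" using z by simp
    then have "z = z0 \<or> z = cnj z0"
      by (rule zeqI[OF _ z0r J(1) J(1)]) (simp add: J(2) q0 Q0 omult.zero_right)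
    then have "z = z0" using cnj0 by auto
    then show False using z r by simp
  qed
  then obtain c d where cd: "c > 0" "d > 0" "\<And>q z. norm (q - q0) < d \<Longrightarrow> z \<in> sphere z0 r \<Longrightarrow> c \<le> norm (N q z)"
    using N_bounded_below_near[of "sphere z0 r" q0] cb by (auto simp: subset_iff)
  \<comment> \<open>The bound 1 makes \<open>Q\<close> Lipschitz with constant 1 near
    \<open>z0\<close>. The other one is set for the final comparison, which sets
    \<open>2 * c \<le> 16 * r\<^sup>2 * \<sigma>\<close> against
    \<open>16 * r\<^sup>2 * \<sigma> \<le> c\<close>.\<close>
  define \<sigma> where "\<sigma> = min 1 (c / (16 * r\<^sup>2))"
  have \<sigma>: "\<sigma> > 0" "\<sigma> \<le> 1" "16 * r\<^sup>2 * \<sigma> \<le> c"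
    using cd r by (auto simp: \<sigma>_def min_def field_simps)
  have ev: "\<forall>\<^sub>F z in nhds z0. norm (P z - P z0) < d / 2 \<and> norm (Q z) < d / 2 \<and> norm (A z) + norm (B z) < \<sigma> \<and> dist z z0 < r"
  proof (intro eventually_conj)
    have "isCont P z0" "isCont Q z0" "isCont A z0" "isCont B z0"
      using cont_P cont_Q cont_A cont_B open_D z0 by (simp_all add: continuous_on_eq_continuous_at)
    then have t: "(P \<longlongrightarrow> P z0) (nhds z0)" "(Q \<longlongrightarrow> 0) (nhds z0)" "(A \<longlongrightarrow> 0) (nhds z0)" "(B \<longlongrightarrow> 0) (nhds z0)"
      by (simp_all add: isCont_def tendsto_nhds_iff A0 B0 Q0)
    show "\<forall>\<^sub>F z in nhds z0. norm (P z - P z0) < d / 2" "\<forall>\<^sub>F z in nhds z0. norm (Q z) < d / 2"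
      using tendstoD[OF t(1), of "d / 2"] tendstoD[OF t(2), of "d / 2"] cd(2) by (simp_all add: dist_norm)
    have "((\<lambda>z. norm (A z) + norm (B z)) \<longlongrightarrow> norm (0::octonion) + norm (0::octonion)) (nhds z0)"
      by (intro tendsto_intros t)
    then show "\<forall>\<^sub>F z in nhds z0. norm (A z) + norm (B z) < \<sigma>"
      using \<sigma> by (intro order_tendstoD(2)) auto
    show "\<forall>\<^sub>F z in nhds z0. dist z z0 < r"
      using r by (auto simp: eventually_nhds_metric)
  qed
  then obtain \<eta> where \<eta>: "\<eta> > 0" "\<And>z. dist z z0 < \<eta> \<Longrightarrow> norm (P z - P z0) < d / 2 \<and> norm (Q z) < d / 2 \<and>
      norm (A z) + norm (B z) < \<sigma> \<and> dist z z0 < r"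
    unfolding eventually_nhds_metric by auto
  have sub: "ball z0 \<eta> \<subseteq> cball z0 r" using \<eta>(2) by (force simp: dist_commute)
  have "\<exists>z1\<in>ball z0 \<eta>. Im z1 > 0 \<and> (\<exists>J1\<in>imag_units. Nd (P z1 + J1 \<odot> Q z1) z1 \<noteq> 0)"
  proof (rule ccontr)
    assume no: "\<not> ?thesis"
    \<comment> \<open>The half disc avoids the real axis, where \<open>Q\<close> vanishes, and is
      convex, so that \<open>P\<close> and \<open>Q\<close> would be constant on it.\<close>
    define S where "S = ball z0 \<eta> \<inter> {z. Im z > 0}"
    have AB: "A z = 0" "B z = 0" if "z \<in> S" for z
    proof -
      have "Nd (P z + K \<odot> Q z) z = 0" if "K \<in> imag_units" for K
        using no \<open>z \<in> S\<close> that by (auto simp: S_def)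
      moreover have "Q z \<noteq> 0" using Qnz[of z] that sub by (auto simp: S_def)
      ultimately show "A z = 0" "B z = 0" using A_B_eq_0_if_Nd_eq_0_near[OF J0 zero_less_one] by auto
    qed
    \<comment> \<open>Two heights on one vertical line: neither equal nor conjugate.\<close>
    define w1 w2 where "w1 = z0 + Complex 0 (\<eta> / 2)" and "w2 = z0 + Complex 0 (\<eta> / 3)"
    have w: "w1 \<in> S" "w2 \<in> S" using \<eta>(1) Im0 by (auto simp: w1_def w2_def S_def dist_norm cmod_def)
    have "convex S" unfolding S_def by (intro convex_Int convex_ball convex_halfspace_Im_gt)
    moreover have "S \<subseteq> D" using sub cb by (auto simp: S_def)
    ultimately have "P w1 = P w2" "Q w1 = Q w2" using P_Q_constant[of S w1 w2] AB w by auto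
    then have "w1 = w2 \<or> w1 = cnj w2" using w sub J0 by (intro zeqI[of w1 w2 J0 J0]) (auto simp: S_def)
    then show False using \<eta>(1) Im0 by (auto simp: w1_def w2_def complex_eq_iff)
  qed
  then obtain z1 J1 where z1: "z1 \<in> ball z0 \<eta>" "Im z1 > 0" and J1: "J1 \<in> imag_units"
    and Nd1: "Nd (P z1 + J1 \<odot> Q z1) z1 \<noteq> 0" by blast
  define q1 where "q1 = P z1 + J1 \<odot> Q z1"
  have z1D: "z1 \<in> D" using z1 sub cb by auto
  have z1': "norm (P z1 - P z0) < d / 2" "norm (Q z1) < d / 2" "norm (A z1) + norm (B z1) < \<sigma>" "dist z1 z0 < r"
    using \<eta>(2)[of z1] z1 by (auto simp: dist_commute)
  have "norm (q1 - q0) \<le> norm (P z1 - P z0) + norm (J1 \<odot> Q z1)"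
    using norm_triangle_ineq[of "P z1 - P z0" "J1 \<odot> Q z1"] by (simp add: q1_def q0 algebra_simps)
  then have q1: "norm (q1 - q0) < d" using z1' J1 by (simp add: norm_omult imag_units_norm)
  have dist_cnj: "dist (cnj z) z0 = dist z z0" for z
    using complex_mod_cnj[of "z - z0"] by (simp add: dist_norm cnj0)
  have "c * norm (z1 - cnj z1) \<le> (2 * r)\<^sup>2 * norm (deriv (N q1) z1)"
  proof (rule norm_deriv_two_zeros_ge[OF N_holomorphic[OF order_refl] open_D cb])
    show "z1 \<in> ball z0 r" "cnj z1 \<in> ball z0 r" using z1' dist_cnj[of z1] by (simp_all add: dist_commute)
    show "z1 \<noteq> cnj z1" using z1 by (auto simp: complex_eq_iff)
    show "N q1 z1 = 0" unfolding q1_def by (rule N_preimage[OF J1])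
    then show "N q1 (cnj z1) = 0" using N_cnj[OF z1D] by simp
    show "deriv (N q1) z1 \<noteq> 0" "deriv (N q1) (cnj z1) \<noteq> 0"
      using Nd1 deriv_N z1D conj_D Nd_cnj by (simp_all add: q1_def)
    fix z assume z: "z \<in> cball z0 r" and "N q1 z = 0"
    then obtain J where J: "J \<in> imag_units" "P z + J \<odot> Q z = q1" using N_eq_0_imp_preimage by blast
    have "z1 \<in> cball z0 r" using z1 sub by auto
    from zeqI[OF z this J(1) J1] J(2) show "z = z1 \<or> z = cnj z1" by (simp add: q1_def)
  qed (use cd q1 in auto)
  moreover have "norm (z1 - cnj z1) = 2 * Im z1" using z1 by (simp add: complex_diff_cnj norm_mult)
  moreover have "norm (deriv (N q1) z1) \<le> 4 * Im z1 * \<sigma>"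
  proof -
    \<comment> \<open>Mean value inequality starting from the foot \<open>Re z1\<close> of the
      perpendicular to the real axis, where \<open>Q\<close> is 0.\<close>
    have QIm: "norm (Q z1) \<le> Im z1"
    proof -
      have "norm (Q z1 - Q (of_real (Re z1))) \<le> 1 * norm (z1 - of_real (Re z1))"
      proof (rule differentiable_bound[of "ball z0 \<eta>"])
        fix z assume z: "z \<in> ball z0 \<eta>"
        then have zD: "z \<in> D" using sub cb by auto
        show "(Q has_derivative (\<lambda>h. Re h *\<^sub>R B z + Im h *\<^sub>R A z)) (at z within ball z0 \<eta>)"
          using Q_deriv[OF zD] by (rule has_derivative_at_withinI)
        have "norm (A z) + norm (B z) \<le> 1" using \<eta>(2)[of z] z \<sigma>(2) by (auto simp: dist_commute)
        show "onorm (\<lambda>h. Re h *\<^sub>R B z + Im h *\<^sub>R A z) \<le> 1"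
        proof (rule onorm_bound)
          fix h
          have "norm (Re h *\<^sub>R B z + Im h *\<^sub>R A z) \<le> \<bar>Re h\<bar> * norm (B z) + \<bar>Im h\<bar> * norm (A z)"
            using norm_triangle_ineq[of "Re h *\<^sub>R B z" "Im h *\<^sub>R A z"] by simp
          also have "\<dots> \<le> norm h * norm (B z) + norm h * norm (A z)"
            by (intro add_mono mult_right_mono abs_Re_le_cmod abs_Im_le_cmod) auto
          also have "\<dots> \<le> norm h * 1"
            using mult_left_mono[OF \<open>norm (A z) + norm (B z) \<le> 1\<close> norm_ge_zero[of h]] by (simp add: algebra_simps)
          finally show "norm (Re h *\<^sub>R B z + Im h *\<^sub>R A z) \<le> 1 * norm h" by simp
        qed simp
      next
        show "z1 \<in> ball z0 \<eta>" by fact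
        have "norm (of_real (Re z1) - z0) \<le> norm (z1 - z0)"
          using abs_Re_le_cmod[of "z1 - z0"] Im0 by (simp add: cmod_eq_Re)
        then show "complex_of_real (Re z1) \<in> ball z0 \<eta>" using z1(1) by (simp add: dist_norm norm_minus_commute)
      qed auto
      moreover have "Q (of_real (Re z1)) = 0"
      proof (rule real_point)
        have "norm (of_real (Re z1) - z0) \<le> norm (z1 - z0)"
          using abs_Re_le_cmod[of "z1 - z0"] Im0 by (simp add: cmod_eq_Re)
        then show "complex_of_real (Re z1) \<in> D" using z1(1) sub cb by (auto simp: dist_norm norm_minus_commute subset_iff)
      qed simp
      moreover have "norm (z1 - of_real (Re z1)) = Im z1" using z1(2) by (simp add: cmod_eq_Im)
      ultimately show ?thesis by simp
    qed
    have "norm (deriv (N q1) z1) \<le> 4 * norm (Q z1) * (norm (A z1) + norm (B z1))"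
      unfolding deriv_N[OF z1D] q1_def by (rule norm_Nd_preimage_le[OF J1])
    also have "\<dots> \<le> 4 * Im z1 * \<sigma>" using QIm z1' z1 by (intro mult_mono) auto
    finally show ?thesis .
  qed
  ultimately have "c * (2 * Im z1) \<le> (2 * r)\<^sup>2 * (4 * Im z1 * \<sigma>)"
    using mult_left_mono[of "norm (deriv (N q1) z1)" "4 * Im z1 * \<sigma>" "(2 * r)\<^sup>2"] by simp
  then have "Im z1 * (2 * c) \<le> Im z1 * (16 * r\<^sup>2 * \<sigma>)" by (simp add: power2_eq_square algebra_simps)
  then have "2 * c \<le> 16 * r\<^sup>2 * \<sigma>" using z1(2) by (simp only: mult_le_cancel_left_pos)
  then show False using \<sigma>(3) cd(1) by linarith
qed

end

subsection \<open>Smoothness\<close>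

lemma Ck_on_holomorphic_compose:
  assumes "open S" "open T" "h holomorphic_on T" "Ck_on k f S" "f ` S \<subseteq> T"
  shows "Ck_on k (\<lambda>x. h (f x)) S"
  using Ck_on_compose[OF assms(1,2,4) Ck_on_holomorphic[OF assms(2,3)] assms(5)] .

text \<open>The real square root is read off from \<open>csqrt\<close>, holomorphic off the
  nonpositive reals, so that \<open>Ck_on_holomorphic\<close> covers it.\<close>

lemma Ck_on_inverse_norm:
  fixes g :: "'a::euclidean_space \<Rightarrow> 'b::euclidean_space"
  assumes S: "open S" and g: "Ck_on k g S" and nz: "\<And>x. x \<in> S \<Longrightarrow> g x \<noteq> 0"
  shows "Ck_on k (\<lambda>x. norm (g x)) S" "Ck_on k (\<lambda>x. inverse (norm (g x))) S"
proof -
  have o: "open (- \<real>\<^sub>\<le>\<^sub>0 :: complex set)"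
    using closed_nonpos_Reals_complex by (rule open_Compl)
  have h: "csqrt holomorphic_on - \<real>\<^sub>\<le>\<^sub>0" "(\<lambda>z. inverse (csqrt z)) holomorphic_on - \<real>\<^sub>\<le>\<^sub>0"
    by (intro holomorphic_intros; auto)+
  have 1: "Ck_on k (\<lambda>x. complex_of_real (g x \<bullet> g x)) S"
    by (intro Ck_on_linear_compose[OF S bounded_linear_of_real] Ck_on_inner S g)
  have 2: "(\<lambda>x. complex_of_real (g x \<bullet> g x)) ` S \<subseteq> - \<real>\<^sub>\<le>\<^sub>0"
  proof (rule image_subsetI)
    fix x assume "x \<in> S"
    then have "g x \<bullet> g x > 0" using nz by simp
    then show "complex_of_real (g x \<bullet> g x) \<in> - \<real>\<^sub>\<le>\<^sub>0" by (simp del: inner_gt_zero_iff)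
  qed
  have c: "csqrt (complex_of_real (g x \<bullet> g x)) = of_real (norm (g x))" for x
    by (simp add: norm_eq_sqrt_inner)
  have 3: "norm (g x) = Re (csqrt (complex_of_real (g x \<bullet> g x)))"
    "inverse (norm (g x)) = Re (inverse (csqrt (complex_of_real (g x \<bullet> g x))))" for x
    by (simp_all only: c of_real_inverse[symmetric] Re_complex_of_real)
  show "Ck_on k (\<lambda>x. norm (g x)) S" "Ck_on k (\<lambda>x. inverse (norm (g x))) S"
    using Ck_on_linear_compose[OF S bounded_linear_Re Ck_on_holomorphic_compose[OF S o h(1) 1 2]]
      Ck_on_linear_compose[OF S bounded_linear_Re Ck_on_holomorphic_compose[OF S o h(2) 1 2]]
    by (simp_all only: 3[symmetric])
qed

text \<open>The velocity of the circle is \<open>2 * pi * \<i>\<close> times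
  \<open>circlepath a r t - a\<close>; this turns the contour integral into an ordinary integral
  over t whose kernel depends smoothly on \<open>z\<close>.\<close>

lemma has_integral_Cauchy_circle:
  assumes h: "h holomorphic_on cball a r" and z: "norm (z - a) < r"
  shows "((\<lambda>t. h (circlepath a r t) * (circlepath a r t - a) / (circlepath a r t - z)) has_integral h z) {0..1}"
proof -
  have "((\<lambda>u. h u / (u - z)) has_contour_integral (2 * of_real pi * \<i> * h z)) (circlepath a r)"
    by (rule Cauchy_integral_circlepath_simple[OF h z])
  then have "((\<lambda>t. h (circlepath a r t) / (circlepath a r t - z) *
      (2 * pi * \<i> * r * exp (2 * of_real pi * \<i> * t))) has_integral 2 * of_real pi * \<i> * h z) {0..1}"
    unfolding has_contour_integral_def
    by (rule has_integral_eq[rotated]) (simp add: vector_derivative_circlepath01)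
  from has_integral_mult_right[OF this, of "inverse (2 * of_real pi * \<i>)"]
  show ?thesis
    by (rule has_integral_eq_rhs[OF has_integral_eq[rotated]]) (auto simp: circlepath field_simps)
qed

section \<open>Smoothness of the stem function\<close>

context stem
begin

text \<open>The complex components of \<open>P + \<iota> Q\<close>; being scalar holomorphic
  functions, they admit Cauchy's formula.\<close>

definition \<phi> :: "octonion \<Rightarrow> complex \<Rightarrow> complex" where
  "\<phi> b z = Complex (P z \<bullet> b) (Q z \<bullet> b)"

lemma \<phi>_holomorphic: "\<phi> b holomorphic_on D"
proof -
  have "(\<phi> b has_field_derivative Complex (A z \<bullet> b) (B z \<bullet> b)) (at z)" if z: "z \<in> D" for z
  proof -
    have "((\<lambda>z. of_real (P z \<bullet> b) + \<i> * of_real (Q z \<bullet> b)) has_derivative (\<lambda>h. Complex (A z \<bullet> b) (B z \<bullet> b) * h)) (at z)"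
      by (auto intro!: derivative_eq_intros P_deriv[OF z] Q_deriv[OF z]
        simp: fun_eq_iff complex_eq_iff inner_diff_left inner_add_left algebra_simps)
    then show ?thesis unfolding has_field_derivative_def \<phi>_def[abs_def] Complex_eq .
  qed
  then show ?thesis
    unfolding holomorphic_on_def field_differentiable_def using has_field_derivative_at_within by blast
qed

lemma \<phi>_cnj: "z \<in> D \<Longrightarrow> \<phi> b (cnj z) = cnj (\<phi> b z)"
  by (simp add: \<phi>_def P_cnj Q_cnj complex_eq_iff)

lemma P_eq_\<phi>: "P z = (\<Sum>b\<in>Basis. Re (\<phi> b z) *\<^sub>R b)" and Q_eq_\<phi>: "Q z = (\<Sum>b\<in>Basis. Im (\<phi> b z) *\<^sub>R b)"
  unfolding \<phi>_def complex.sel by (rule euclidean_representation[symmetric])+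

lemma Ck_on_P: "Ck_on k P D" and Ck_on_Q: "Ck_on k Q D"
proof -
  have \<phi>: "Ck_on k (\<phi> b) D" for b by (rule Ck_on_holomorphic[OF open_D \<phi>_holomorphic])
  have "Ck_on k (\<lambda>z. \<Sum>b\<in>Basis. Re (\<phi> b z) *\<^sub>R b) D" "Ck_on k (\<lambda>z. \<Sum>b\<in>Basis. Im (\<phi> b z) *\<^sub>R b) D"
    by (rule Ck_on_sum[OF open_D Ck_on_scaleR[OF open_D]];
        intro Ck_on_const open_D Ck_on_linear_compose[OF open_D _ \<phi>] bounded_linear_Re bounded_linear_Im)+
  then show "Ck_on k P D" "Ck_on k Q D" by (simp_all only: P_eq_\<phi>[symmetric] Q_eq_\<phi>[symmetric])
qed

end

section \<open>Smoothness of slice functions off and across the real axis\<close>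

context slice_function
begin

lemma smooth_on_nonreal:
  "smooth_on f {x. zcoord x \<in> D \<and> oim x \<noteq> 0}" and open_nonreal: "open {x. zcoord x \<in> D \<and> oim x \<noteq> 0}"
proof -
  define S where "S = {x. zcoord x \<in> D \<and> oim x \<noteq> 0}"
  have oim: "continuous_on UNIV oim" using bounded_linear_oim by (rule linear_continuous_on)
  have "S = zcoord -` D \<inter> oim -` (- {0})" by (auto simp: S_def)
  then show S: "open {x. zcoord x \<in> D \<and> oim x \<noteq> 0}"
    using open_Int[OF open_vimage[OF open_D continuous_on_zcoord] open_vimage[OF open_Compl[OF closed_singleton] oim]]
    by (simp add: S_def)
  then have S: "open S" by (simp add: S_def)
  have "Ck_on k f S" for k
  proof -
    have o: "Ck_on k oim S" using S bounded_linear_oim by (rule Ck_on_linear)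
    have n: "Ck_on k (\<lambda>x. norm (oim x)) S" "Ck_on k (\<lambda>x. inverse (norm (oim x))) S"
      by (rule Ck_on_inverse_norm[OF S o]; simp add: S_def)+
    have "Ck_on k (\<lambda>x. of_real (x \<bullet> oone) + \<i> * of_real (norm (oim x))) S"
      by (intro Ck_on_add Ck_on_mult Ck_on_const S Ck_on_linear_compose[OF S bounded_linear_of_real] n
          Ck_on_linear bounded_linear_inner_left)
    then have z: "Ck_on k zcoord S" unfolding zcoord_def[abs_def] Complex_eq .
    have im: "zcoord ` S \<subseteq> D" by (auto simp: S_def)
    have "Ck_on k (\<lambda>x. P (zcoord x) + inverse (norm (oim x)) *\<^sub>R (oim x \<odot> Q (zcoord x))) S"
      by (intro Ck_on_add Ck_on_scaleR Ck_on_bilinear[OF _ bounded_bilinear_omult] S o n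
          Ck_on_compose[OF S open_D z Ck_on_P im] Ck_on_compose[OF S open_D z Ck_on_Q im])
    then show ?thesis
      by (rule iffD1[OF Ck_on_cong[OF S], rotated]) (simp add: S_def f_eq sgn_div_norm omult.scaleR_left)
  qed
  then show "smooth_on f {x. zcoord x \<in> D \<and> oim x \<noteq> 0}" by (simp add: smooth_on_def S_def)
qed

text \<open>
  Near a real point the factor \<open>Q z / Im z\<close> is not visibly smooth in \<open>x\<close>. Adding and subtracting
  the Cauchy formulas at \<open>z\<close> and its conjugate turns the kernel \<open>1 / (w - z)\<close> into one whose
  denominator \<open>w\<^sup>2 - 2 \<alpha> w + \<bar>x\<bar>\<^sup>2\<close> is polynomial in \<open>x\<close>.
\<close>

lemma smooth_on_ball_real:
  assumes x0: "oim x0 = 0" and r: "r > 0" "cball (zcoord x0) r \<subseteq> D"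
  shows "smooth_on f (ball x0 r)"
  unfolding smooth_on_def
proof
  fix k
  define a S \<gamma> where "a = zcoord x0" and "S = ball x0 r" and "\<gamma> = circlepath a r"
  define den where "den p = (\<gamma> (fst p))\<^sup>2 - of_real (2 * (snd p \<bullet> oone)) * \<gamma> (fst p) + of_real (snd p \<bullet> snd p)"
    for p :: "real \<times> octonion"
  \<comment> \<open>With z the coordinate of x, \<open>K0\<close> comes from half the sum of the
    Cauchy kernels at z and its conjugate, \<open>K1\<close> from their difference divided by
    \<open>z - cnj z\<close>; they reproduce the components of \<open>P\<close> and of
    \<open>Q\<close> over \<open>norm (oim x)\<close>.\<close>
  define K0 where "K0 b p = \<phi> b (\<gamma> (fst p)) * (\<gamma> (fst p) - a) * (\<gamma> (fst p) - of_real (snd p \<bullet> oone)) * inverse (den p)"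
    for b and p :: "real \<times> octonion"
  define K1 where "K1 b p = \<phi> b (\<gamma> (fst p)) * (\<gamma> (fst p) - a) * inverse (den p)"
    for b and p :: "real \<times> octonion"
  have Ima: "Im a = 0" using x0 by (simp add: a_def zcoord_def)
  have cnja: "cnj a = a" using Ima by (simp add: complex_eq_iff)
  have S: "open S" "convex S" by (simp_all add: S_def)
  have US: "open (UNIV \<times> S :: (real \<times> octonion) set)" using S by (simp add: open_Times)
  have \<gamma>_norm: "norm (\<gamma> t - a) = r" for t
    using r by (simp add: \<gamma>_def circlepath norm_mult)
  then have \<gamma>_D: "\<gamma> t \<in> D" for t using r(2) by (auto simp: a_def dist_norm norm_minus_commute subset_iff)
  have zS: "norm (zcoord x - a) < r" "norm (cnj (zcoord x) - a) < r" "zcoord x \<in> D" if "x \<in> S" for x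
  proof -
    obtain J where J: "J \<in> imag_units" and x: "x = point (zcoord x) J" by (rule ex_point)
    have "x0 = point a J" using point_zcoord[of x0] Ima by (simp add: a_def point_def)
    then have "norm (zcoord x - a) = norm (x - x0)" using norm_point_diff[OF J, of "zcoord x" a] x by simp
    then show 1: "norm (zcoord x - a) < r" using that by (simp add: S_def dist_norm norm_minus_commute)
    then show "norm (cnj (zcoord x) - a) < r" using complex_mod_cnj[of "zcoord x - a"] by (simp add: cnja)
    show "zcoord x \<in> D" using 1 r(2) by (auto simp: a_def dist_norm norm_minus_commute subset_iff)
  qed
  have den: "den (t, x) = (\<gamma> t - zcoord x) * (\<gamma> t - cnj (zcoord x))" for t x
  proof -
    have "zcoord x + cnj (zcoord x) = of_real (2 * (x \<bullet> oone))"
      by (simp add: zcoord_def complex_eq_iff)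
    moreover have "zcoord x * cnj (zcoord x) = of_real (x \<bullet> x)"
      by (simp add: zcoord_def complex_eq_iff inner_eq_oim[of x x] power2_norm_eq_inner flip: power2_eq_square)
    moreover have "(\<gamma> t - zcoord x) * (\<gamma> t - cnj (zcoord x)) =
      (\<gamma> t)\<^sup>2 - (zcoord x + cnj (zcoord x)) * \<gamma> t + zcoord x * cnj (zcoord x)"
      by (simp add: power2_eq_square algebra_simps)
    ultimately show ?thesis by (simp add: den_def)
  qed
  have nz: "\<gamma> t - zcoord x \<noteq> 0" "\<gamma> t - cnj (zcoord x) \<noteq> 0" if "x \<in> S" for t x
    using \<gamma>_norm[of t] zS[OF that] by auto
  have CkK: "Ck_on k (K0 b) (UNIV \<times> S)" "Ck_on k (K1 b) (UNIV \<times> S)" for b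
  proof -
    \<comment> \<open>The exponential formula describes the circle for all real t, so the kernels
      are C^k on the open set that \<open>Ck_on_integral\<close> asks for.\<close>
    have "Ck_on k (\<lambda>p. a + r * exp (2 * of_real pi * \<i> * of_real (fst p))) (UNIV \<times> S)"
    proof (rule Ck_on_holomorphic_compose[OF US open_UNIV, where h = "\<lambda>z. a + r * exp (2 * of_real pi * \<i> * z)"])
      show "(\<lambda>z. a + r * exp (2 * of_real pi * \<i> * z)) holomorphic_on UNIV" by (intro holomorphic_intros)
      show "Ck_on k (\<lambda>p. complex_of_real (fst p)) (UNIV \<times> S)"
        by (intro Ck_on_linear_compose[OF US bounded_linear_of_real] Ck_on_linear US bounded_linear_fst)
    qed auto
    then have g: "Ck_on k (\<lambda>p. \<gamma> (fst p)) (UNIV \<times> S)" by (simp add: \<gamma>_def circlepath)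
    have s: "Ck_on k (\<lambda>p :: real \<times> octonion. snd p) (UNIV \<times> S)" by (intro Ck_on_linear US bounded_linear_snd)
    have so: "Ck_on k (\<lambda>p :: real \<times> octonion. complex_of_real (snd p \<bullet> oone)) (UNIV \<times> S)" "Ck_on k (\<lambda>p :: real \<times> octonion. complex_of_real (snd p \<bullet> snd p)) (UNIV \<times> S)"
      "Ck_on k (\<lambda>p :: real \<times> octonion. complex_of_real (2 * (snd p \<bullet> oone))) (UNIV \<times> S)"
      by (intro Ck_on_linear_compose[OF US bounded_linear_of_real] Ck_on_mult Ck_on_inner Ck_on_const US s)+
    have Ck_den: "Ck_on k den (UNIV \<times> S)"
      unfolding den_def[abs_def] power2_eq_square by (intro Ck_on_add Ck_on_diff Ck_on_mult US g so)
    have i: "Ck_on k (\<lambda>p. inverse (den p)) (UNIV \<times> S)"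
    proof (rule Ck_on_holomorphic_compose[OF US _ _ Ck_den, where T = "- {0}" and h = inverse])
      show "inverse holomorphic_on - {0}" by (intro holomorphic_intros) auto
      show "den ` (UNIV \<times> S) \<subseteq> - {0}" using den nz by auto
    qed auto
    have \<phi>: "Ck_on k (\<lambda>p. \<phi> b (\<gamma> (fst p))) (UNIV \<times> S)"
      by (rule Ck_on_holomorphic_compose[OF US open_D \<phi>_holomorphic g]) (use \<gamma>_D in auto)
    show "Ck_on k (K0 b) (UNIV \<times> S)" "Ck_on k (K1 b) (UNIV \<times> S)"
      unfolding K0_def[abs_def] K1_def[abs_def] by (intro Ck_on_mult Ck_on_diff Ck_on_const US g so i \<phi>)+
  qed
  have Cauchy: "((\<lambda>t. \<phi> b (\<gamma> t) * (\<gamma> t - a) / (\<gamma> t - z)) has_integral \<phi> b z) {0..1}" if "norm (z - a) < r" for b z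
    unfolding \<gamma>_def using r(2) that
    by (intro has_integral_Cauchy_circle holomorphic_on_subset[OF \<phi>_holomorphic]) (auto simp: a_def)
  have I0: "integral {0..1} (\<lambda>t. K0 b (t, x)) = of_real (Re (\<phi> b (zcoord x)))" if x: "x \<in> S" for b x
  proof (rule integral_unique)
    have "((\<lambda>t. (\<phi> b (\<gamma> t) * (\<gamma> t - a) / (\<gamma> t - zcoord x) + \<phi> b (\<gamma> t) * (\<gamma> t - a) / (\<gamma> t - cnj (zcoord x))) * (1 / 2))
      has_integral (\<phi> b (zcoord x) + \<phi> b (cnj (zcoord x))) * (1 / 2)) {0..1}"
      by (intro has_integral_mult_left has_integral_add Cauchy zS[OF x])
    moreover have "(\<phi> b (zcoord x) + \<phi> b (cnj (zcoord x))) * (1 / 2) = of_real (Re (\<phi> b (zcoord x)))"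
      by (simp add: \<phi>_cnj zS[OF x] complex_eq_iff)
    moreover have "(\<phi> b (\<gamma> t) * (\<gamma> t - a) / (\<gamma> t - zcoord x) + \<phi> b (\<gamma> t) * (\<gamma> t - a) / (\<gamma> t - cnj (zcoord x))) * (1 / 2) = K0 b (t, x)" for t
    proof -
      have \<alpha>: "complex_of_real (x \<bullet> oone) = (zcoord x + cnj (zcoord x)) / 2"
        by (simp add: zcoord_def complex_eq_iff)
      have "(c / u + c / v) * (1 / 2) = c * ((u + v) / 2) * inverse (u * v)"
        if "u \<noteq> 0" "v \<noteq> 0" for c u v :: complex
        using that by (simp add: field_simps)
      from this[OF nz[OF x, of t]] show ?thesis
        unfolding K0_def den fst_conv snd_conv \<alpha> by (simp add: diff_divide_distrib add_divide_distrib)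
        qed
    ultimately show "((\<lambda>t. K0 b (t, x)) has_integral of_real (Re (\<phi> b (zcoord x)))) {0..1}" by simp
  qed
  have I1: "integral {0..1} (\<lambda>t. K1 b (t, x)) = of_real (Im (\<phi> b (zcoord x)) / norm (oim x))"
    if x: "x \<in> S" "oim x \<noteq> 0" for b x
  proof (rule integral_unique)
    define d where "d = zcoord x - cnj (zcoord x)"
    have d: "d = 2 * \<i> * of_real (norm (oim x))" by (simp add: d_def zcoord_def complex_eq_iff)
    have d0: "d \<noteq> 0" using x by (simp add: d)
    have "((\<lambda>t. (\<phi> b (\<gamma> t) * (\<gamma> t - a) / (\<gamma> t - zcoord x) - \<phi> b (\<gamma> t) * (\<gamma> t - a) / (\<gamma> t - cnj (zcoord x))) * (1 / d))
      has_integral (\<phi> b (zcoord x) - \<phi> b (cnj (zcoord x))) * (1 / d)) {0..1}"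
      by (intro has_integral_mult_left has_integral_diff Cauchy zS[OF x(1)])
    moreover have "(\<phi> b (zcoord x) - \<phi> b (cnj (zcoord x))) * (1 / d) = of_real (Im (\<phi> b (zcoord x)) / norm (oim x))"
    proof -
      have "\<phi> b (zcoord x) - \<phi> b (cnj (zcoord x)) = 2 * \<i> * of_real (Im (\<phi> b (zcoord x)))"
        by (simp add: \<phi>_cnj zS[OF x(1)] complex_eq_iff)
      then show ?thesis by (simp add: d)
    qed
    moreover have "(\<phi> b (\<gamma> t) * (\<gamma> t - a) / (\<gamma> t - zcoord x) - \<phi> b (\<gamma> t) * (\<gamma> t - a) / (\<gamma> t - cnj (zcoord x))) * (1 / d) = K1 b (t, x)" for t
    proof -
      have "1 / (\<gamma> t - zcoord x) - 1 / (\<gamma> t - cnj (zcoord x)) = d / ((\<gamma> t - zcoord x) * (\<gamma> t - cnj (zcoord x)))"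
        using nz[OF x(1), of t] unfolding d_def by (simp add: diff_frac_eq)
      then have "1 / (\<gamma> t - zcoord x) - 1 / (\<gamma> t - cnj (zcoord x)) = d * inverse (den (t, x))"
        by (simp add: den divide_inverse)
      moreover have "K1 b (t, x) = \<phi> b (\<gamma> t) * (\<gamma> t - a) * (d * inverse (den (t, x))) * (1 / d)"
        using d0 by (simp add: K1_def)
      ultimately have "K1 b (t, x) = \<phi> b (\<gamma> t) * (\<gamma> t - a) * (1 / (\<gamma> t - zcoord x) - 1 / (\<gamma> t - cnj (zcoord x))) * (1 / d)"
        by simp
      then show ?thesis by (simp add: right_diff_distrib)
    qed
    ultimately show "((\<lambda>t. K1 b (t, x)) has_integral of_real (Im (\<phi> b (zcoord x)) / norm (oim x))) {0..1}" by simp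
  qed
  \<comment> \<open>\<open>f x\<close> is rewritten with \<open>oim x\<close> as a smooth factor in
    place of the unit; at real \<open>x\<close> that factor is 0, so whatever \<open>K1\<close>
    integrates to there does no harm.\<close>
  let ?g = "\<lambda>x. (\<Sum>b\<in>Basis. Re (integral {0..1} (\<lambda>t. K0 b (t, x))) *\<^sub>R b) +
      oim x \<odot> (\<Sum>b\<in>Basis. Re (integral {0..1} (\<lambda>t. K1 b (t, x))) *\<^sub>R b)"
  have "Ck_on k ?g S"
    by (intro Ck_on_add Ck_on_sum Ck_on_scaleR Ck_on_bilinear[OF _ bounded_bilinear_omult] Ck_on_const S(1)
        Ck_on_linear[OF S(1) bounded_linear_oim] Ck_on_linear_compose[OF S(1) bounded_linear_Re] Ck_on_integral[OF S CkK(1)]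
        Ck_on_integral[OF S CkK(2)])
  moreover have "?g x = f x" if x: "x \<in> S" for x
  proof (cases "oim x = 0")
    case True
    then show ?thesis using f_eq[OF zS(3)[OF x]] by (simp add: I0[OF x] P_eq_\<phi>[of "zcoord x"] omult.zero_left)
  next
    case False
    have "(\<Sum>b\<in>Basis. Re (integral {0..1} (\<lambda>t. K1 b (t, x))) *\<^sub>R b) = Q (zcoord x) /\<^sub>R norm (oim x)"
      unfolding I1[OF x False] Re_complex_of_real Q_eq_\<phi>[of "zcoord x"]
      by (simp add: scaleR_sum_right divide_inverse_commute)
    then show ?thesis using f_eq[OF zS(3)[OF x]]
      by (simp add: I0[OF x] P_eq_\<phi>[of "zcoord x"] sgn_div_norm omult.scaleR_left omult.scaleR_right)
  qed
  ultimately show "Ck_on k f (ball x0 r)" using Ck_on_cong[OF S(1), of ?g f] by (simp add: S_def)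
qed

lemma smooth_near:
  assumes "zcoord x \<in> D"
  obtains W where "open W" "x \<in> W" "W \<subseteq> zcoord -` D" "smooth_on f W"
proof (cases "oim x = 0")
  case True
  obtain e where e: "e > 0" "cball (zcoord x) e \<subseteq> D" using open_D assms open_contains_cball by blast
  have "open (zcoord -` D)" using open_vimage[OF open_D continuous_on_zcoord] .
  then obtain e' where e': "e' > 0" "ball x e' \<subseteq> zcoord -` D" using assms openE by blast
  show ?thesis
  proof (rule that[of "ball x (min e e')"])
    show "smooth_on f (ball x (min e e'))"
      using smooth_on_ball_real[OF True e] Ck_on_subset[of _ f "ball x e" "ball x (min e e')"]
      unfolding smooth_on_def by (meson min.cobounded1 subset_ball)
    show "ball x (min e e') \<subseteq> zcoord -` D" using e'(2) by auto
  qed (use e e' in auto)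
next
  case False
  then show ?thesis using that[OF open_nonreal _ _ smooth_on_nonreal] assms by auto
qed

end

subsection \<open>Branch set and singular set\<close>

context slice_function
begin

lemma open_circular: "open (zcoord -` D)"
  using open_vimage[OF open_D continuous_on_zcoord] .

lemma local_diffeomorphism:
  assumes "x \<in> zcoord -` D - singular_set (zcoord -` D) f"
  obtains U where "open U" "U \<subseteq> zcoord -` D" "x \<in> U" "open (f ` U)" "diffeomorphism U (f ` U) f"
    "homeomorphism U (f ` U) f (inv_into U f)"
proof -
  obtain W where W: "open W" "x \<in> W" "W \<subseteq> zcoord -` D" "smooth_on f W"
    using smooth_near[of x] assms by blast
  have "bij (frechet_derivative f (at x))" using assms by (simp add: singular_set_def)
  from smooth_inverse_function_theorem[OF W(1,4,2) this] obtain U where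
    "open U" "U \<subseteq> W" "x \<in> U" "diffeomorphism U (f ` U) f" "homeomorphism U (f ` U) f (inv_into U f)" by blast
  then show ?thesis using that[of U] W(3) by (auto simp: diffeomorphism_def)
qed

lemma singular_imp_not_inj_on:
  assumes x: "x \<in> singular_set (zcoord -` D) f" and W: "open W" "x \<in> W" "W \<subseteq> zcoord -` D"
  shows "\<not> inj_on f W"
proof -
  obtain \<epsilon> where \<epsilon>: "\<epsilon> > 0" "ball x \<epsilon> \<subseteq> W" using W openE by blast
  then have "\<not> inj_on f (ball x \<epsilon>)"
    using not_inj_on_ball_nonreal[of \<epsilon> x] not_inj_on_ball_real[of \<epsilon> x] W x by (auto simp: singular_set_def)
  then show ?thesis using \<epsilon> inj_on_subset by blast
qed

text \<open>At a singular point it is the failure of injectivity alone that rules out a local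
  homeomorphism.\<close>

lemma branch_set_eq: "branch_set (zcoord -` D) f = singular_set (zcoord -` D) f"
proof (intro equalityI subsetI)
  fix x assume x: "x \<in> branch_set (zcoord -` D) f"
  show "x \<in> singular_set (zcoord -` D) f"
  proof (rule ccontr)
    assume "x \<notin> singular_set (zcoord -` D) f"
    moreover have "x \<in> zcoord -` D" using x by (simp add: branch_set_def)
    ultimately obtain U where "open U" "U \<subseteq> zcoord -` D" "x \<in> U" "open (f ` U)"
      "homeomorphism U (f ` U) f (inv_into U f)" using local_diffeomorphism[of x] by blast
    then show False using x open_subset[of U "zcoord -` D"] unfolding branch_set_def by blast
  qed
next
  fix x assume x: "x \<in> singular_set (zcoord -` D) f"
  have "False" if U: "openin (top_of_set (zcoord -` D)) U" "x \<in> U" "homeomorphism U (f ` U) f g" for U g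
  proof -
    have "open U" "U \<subseteq> zcoord -` D" using U(1) open_circular by (auto simp: openin_open_eq)
    then show False using singular_imp_not_inj_on[OF x] U(2) homeomorphism_imp_inj_on[OF U(3)] by blast
  qed
  then show "x \<in> branch_set (zcoord -` D) f" using x unfolding branch_set_def singular_set_def by blast
qed

lemma proper_imp_branched_covering:
  assumes "proper_map (top_of_set (zcoord -` D - singular_set (zcoord -` D) f))
    (top_of_set (f ` (zcoord -` D - singular_set (zcoord -` D) f))) f"
  shows "branched_covering (zcoord -` D) f"
proof -
  let ?S = "zcoord -` D - singular_set (zcoord -` D) f"
  have loc: "\<exists>U g. open U \<and> U \<subseteq> ?S \<and> x \<in> U \<and> open (f ` U) \<and> homeomorphism U (f ` U) f g" if x: "x \<in> ?S" for x
  proof -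
    obtain U where U: "open U" "U \<subseteq> zcoord -` D" "x \<in> U" "open (f ` U)" "homeomorphism U (f ` U) f (inv_into U f)"
      using local_diffeomorphism[OF x] by blast
    \<comment> \<open>\<open>f\<close> is injective on \<open>U\<close>, so \<open>U\<close>
      contains no singular point; this also shows that the regular points form an open set.\<close>
    have "U \<inter> singular_set (zcoord -` D) f = {}"
      using singular_imp_not_inj_on[OF _ U(1) _ U(2)] homeomorphism_imp_inj_on[OF U(5)] by blast
    then show ?thesis using U by blast
  qed
  have S: "open ?S"
    unfolding open_subopen[of ?S] using loc by meson
  have "continuous_on ?S f"
  proof (rule continuous_at_imp_continuous_on, rule)
    fix x assume "x \<in> ?S"
    then obtain U g where "open U" "x \<in> U" "homeomorphism U (f ` U) f g" using loc by blast
    then show "isCont f x" by (metis homeomorphism_cont1 continuous_on_eq_continuous_at)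
  qed
  then show ?thesis
    unfolding branched_covering_def branch_set_eq
    using proper_local_homeomorphism_imp_covering_space[OF S _ assms loc] by blast
qed

end

lemma slice_regular_imp_slice_function:
  assumes "slice_regular \<Omega> f"
  obtains D P Q A B where "slice_function D P Q A B f" "\<Omega> = zcoord -` D"
proof -
  obtain D F where D: "open D" "conj_invariant D" "\<Omega> = circular_set D"
    and F: "stem_function D F" "holomorphic_stem D F" "induces D F f"
    using assms unfolding slice_regular_def by blast
  obtain F' where F': "\<And>z. z \<in> D \<Longrightarrow> (F has_derivative blinfun_apply (F' z)) (at z)"
    and cont: "continuous_on D F'"
    and CR: "\<And>z. z \<in> D \<Longrightarrow> blinfun_apply (F' z) 1 + iota_mult (blinfun_apply (F' z) \<i>) = 0"
    using F(2) unfolding holomorphic_stem_def by blast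
  define A B where "A z = fst (blinfun_apply (F' z) 1)" and "B z = snd (blinfun_apply (F' z) 1)" for z
  have F'h: "blinfun_apply (F' z) h = (Re h *\<^sub>R A z - Im h *\<^sub>R B z, Re h *\<^sub>R B z + Im h *\<^sub>R A z)"
    if z: "z \<in> D" for z h
  proof -
    \<comment> \<open>The Cauchy-Riemann equation determines one partial derivative from the other,
      so \<open>A\<close> and \<open>B\<close> describe the whole differential.\<close>
    have "blinfun_apply (F' z) \<i> = (- B z, A z)"
      using CR[OF z] unfolding A_def B_def iota_mult_def by (simp add: prod_eq_iff eq_neg_iff_add_eq_0 add.commute)
    moreover have "blinfun_apply (F' z) 1 = (A z, B z)" by (simp add: A_def B_def)
    moreover have "h = Re h *\<^sub>R 1 + Im h *\<^sub>R \<i>" by (simp add: complex_eq_iff)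
    then have "blinfun_apply (F' z) h = Re h *\<^sub>R blinfun_apply (F' z) 1 + Im h *\<^sub>R blinfun_apply (F' z) \<i>"
      by (metis blinfun.add_right blinfun.scaleR_right)
    ultimately show ?thesis by simp
  qed
  have F'1: "continuous_on D (\<lambda>z. blinfun_apply (F' z) 1)" using cont by (intro continuous_intros)
  have AB: "continuous_on D A" "continuous_on D B"
    unfolding A_def[abs_def] B_def[abs_def]
    by (rule continuous_on_fst[OF F'1]) (rule continuous_on_snd[OF F'1])
  have "slice_function D (\<lambda>z. fst (F z)) (\<lambda>z. snd (F z)) A B f"
  proof
    show "cnj z \<in> D" if "z \<in> D" for z using D(2) that by (simp add: conj_invariant_def)
    show "fst (F (cnj z)) = fst (F z)" "snd (F (cnj z)) = - snd (F z)" if "z \<in> D" for z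
      using F(1) that by (simp_all add: stem_function_def oc_conj_def)
    show "((\<lambda>z. fst (F z)) has_derivative (\<lambda>h. Re h *\<^sub>R A z - Im h *\<^sub>R B z)) (at z)" if z: "z \<in> D" for z
      using has_derivative_fst[OF F'[OF z]] by (simp add: F'h[OF z])
    show "((\<lambda>z. snd (F z)) has_derivative (\<lambda>h. Re h *\<^sub>R B z + Im h *\<^sub>R A z)) (at z)" if z: "z \<in> D" for z
      using has_derivative_snd[OF F'[OF z]] by (simp add: F'h[OF z])
    show "f (point z J) = fst (F z) + J \<odot> snd (F z)" if "z \<in> D" "J \<in> imag_units" for z J
    proof -
      have "Complex (Re z) (Im z) = z" by simp
      then show ?thesis using F(3) that unfolding induces_def point_def by metis
    qed
  qed (use D AB in auto)
  then show ?thesis using that D(3) circular_set_eq[OF D(2)] by blast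
qed

theorem theorem7p4:
  fixes \<Omega> :: "octonion set" and f :: "octonion \<Rightarrow> octonion"
  assumes "slice_domain \<Omega> \<or> product_domain \<Omega>"
    and "slice_regular \<Omega> f"
  shows "branch_set \<Omega> f = singular_set \<Omega> f \<and>
    (\<forall>x0 \<in> \<Omega> - singular_set \<Omega> f.
       \<exists>U. openin (top_of_set \<Omega>) U \<and> x0 \<in> U \<and> open (f ` U) \<and> diffeomorphism U (f ` U) f) \<and>
    (\<forall>x0 \<in> singular_set \<Omega> f. \<forall>U.
       U \<subseteq> \<Omega> \<and> (\<exists>W. openin (top_of_set \<Omega>) W \<and> x0 \<in> W \<and> W \<subseteq> U) \<longrightarrow> \<not> inj_on f U) \<and>
    (proper_map (top_of_set (\<Omega> - singular_set \<Omega> f))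
       (top_of_set (f ` (\<Omega> - singular_set \<Omega> f))) f \<longrightarrow> branched_covering \<Omega> f)"
proof -
  obtain D P Q A B where "slice_function D P Q A B f" and \<Omega>: "\<Omega> = zcoord -` D"
    using slice_regular_imp_slice_function[OF assms(2)] by blast
  then interpret slice_function D P Q A B f by simp
  show ?thesis
    unfolding \<Omega>
  proof (intro conjI ballI allI impI)
    show "branch_set (zcoord -` D) f = singular_set (zcoord -` D) f" by (rule branch_set_eq)
  next
    fix x0 assume "x0 \<in> zcoord -` D - singular_set (zcoord -` D) f"
    then obtain U where "open U" "U \<subseteq> zcoord -` D" "x0 \<in> U" "open (f ` U)" "diffeomorphism U (f ` U) f"
      by (rule local_diffeomorphism)
    then show "\<exists>U. openin (top_of_set (zcoord -` D)) U \<and> x0 \<in> U \<and> open (f ` U) \<and> diffeomorphism U (f ` U) f"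
      using open_subset by blast
  next
    fix x0 U assume x0: "x0 \<in> singular_set (zcoord -` D) f"
      and "U \<subseteq> zcoord -` D \<and> (\<exists>W. openin (top_of_set (zcoord -` D)) W \<and> x0 \<in> W \<and> W \<subseteq> U)"
    then obtain W where W: "openin (top_of_set (zcoord -` D)) W" "x0 \<in> W" "W \<subseteq> U" by blast
    have "open W" "W \<subseteq> zcoord -` D" using W(1) open_circular by (auto simp: openin_open_eq)
    then have "\<not> inj_on f W" using singular_imp_not_inj_on[OF x0] W(2) by blast
    then show "\<not> inj_on f U" using W(3) inj_on_subset by blast
  next
    assume "proper_map (top_of_set (zcoord -` D - singular_set (zcoord -` D) f))
      (top_of_set (f ` (zcoord -` D - singular_set (zcoord -` D) f))) f"
    then show "branched_covering (zcoord -` D) f" by (rule proper_imp_branched_covering)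
  qed
qed

end
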